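(* Let $G$ be a finite graph with no induced cycle whose length is divisible by three. Then $b(G)\le 1$, where $b(G)=\sum_{i}\tilde{b}_i(I(G))$ is the total reduced Betti number of the independence complex of $G$.
   Context: For a finite graph $G$, the independence complex $I(G)$ is the simplicial complex on $V(G)$ whose faces are the independent sets of $G$. $\tilde{b}_i(I(G))$ denotes the $i$-th reduced Betti number of $I(G)$, i.e. the dimension of the $i$-th reduced homology group (rational coefficients), and $b(G)=\sum_i \tilde{b}_i(I(G))$. *)

theory Defs
  imports "Graph_Theory.Pair_Digraph" "Jordan_Normal_Form.VS_Connect" "HOL-Algebra.AbelCoset"
begin

text \<open>
  A finite simple graph is a \<^locale>\<open>pair_graph\<close>: finite vertex set, symmetric and loop-free
  arc relation. The edge \<open>{u, v}\<close> is the pair of arcs \<open>(u, v)\<close>, \<open>(v, u)\<close>.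
\<close>

definition induced_cycle :: "'a pair_pre_digraph \<Rightarrow> 'a list \<Rightarrow> bool" where
  "induced_cycle G vs \<longleftrightarrow>
     3 \<le> length vs \<and> distinct vs \<and> set vs \<subseteq> pverts G \<and>
     (\<forall>i < length vs. \<forall>j < length vs.
        (vs ! i, vs ! j) \<in> parcs G \<longleftrightarrow>
          j = Suc i mod length vs \<or> i = Suc j mod length vs)"

definition independence_complex :: "'a pair_pre_digraph \<Rightarrow> 'a set set" where
  "independence_complex G = {S. S \<subseteq> pverts G \<and> (\<forall>u\<in>S. \<forall>v\<in>S. (u, v) \<notin> parcs G)}"


subsection \<open>Reduced simplicial homology with rational coefficients\<close>

text \<open>
  \<open>K\<close> is a finite simplicial complex given as its set of faces, including the empty face,
  which spans the chains of degree \<open>-1\<close>. An oriented chain of degree \<open>i\<close> is encoded by its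
  coefficients: \<open>c [v\<^sub>0, \<dots>, v\<^sub>i]\<close> is the coefficient of the oriented simplex
  \<open>[v\<^sub>0, \<dots>, v\<^sub>i]\<close>, so that \<open>c\<close> is supported on orderings of \<open>i\<close>-dimensional faces and
  changes sign under transpositions. No ordering of the vertices has to be chosen.
\<close>

definition simplicial_chains :: "'a set set \<Rightarrow> int \<Rightarrow> ('a list \<Rightarrow> rat) set" where
  "simplicial_chains K i = {c.
     (\<forall>xs. c xs \<noteq> 0 \<longrightarrow> distinct xs \<and> set xs \<in> K \<and> int (length xs) = i + 1) \<and>
     (\<forall>xs u v ys. c (xs @ v # u # ys) = - c (xs @ u # v # ys))}"

text \<open>
  The map \<open>[v\<^sub>0, \<dots>, v\<^sub>i] \<mapsto> \<Sum>\<^sub>j (-1)\<^sup>j [v\<^sub>0, \<dots>, v\<^sub>j\<^sub>-\<^sub>1, v\<^sub>j\<^sub>+\<^sub>1, \<dots>, v\<^sub>i]\<close> read off on coefficients: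
  the faces with \<open>[x\<^sub>1, \<dots>, x\<^sub>i]\<close> in their boundary can be oriented as \<open>[v, x\<^sub>1, \<dots>, x\<^sub>i]\<close>,
  and each of these contributes \<open>[x\<^sub>1, \<dots>, x\<^sub>i]\<close> with sign \<open>+1\<close>. In degree \<open>0\<close> this is the
  augmentation.
\<close>

definition simplicial_boundary :: "'a set set \<Rightarrow> ('a list \<Rightarrow> rat) \<Rightarrow> 'a list \<Rightarrow> rat" where
  "simplicial_boundary K c = (\<lambda>xs. \<Sum>v\<in>\<Union>K. c (v # xs))"

definition simplicial_cycles :: "'a set set \<Rightarrow> int \<Rightarrow> ('a list \<Rightarrow> rat) set" where
  "simplicial_cycles K i = {c \<in> simplicial_chains K i. simplicial_boundary K c = (\<lambda>_. 0)}"

definition simplicial_boundaries :: "'a set set \<Rightarrow> int \<Rightarrow> ('a list \<Rightarrow> rat) set" where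
  "simplicial_boundaries K i = simplicial_boundary K ` simplicial_chains K (i + 1)"

text \<open>
  In module records the fields \<^const>\<open>mult\<close> and \<^const>\<open>one\<close> play no role.
\<close>

definition cycle_space :: "'a set set \<Rightarrow> int \<Rightarrow> (rat, 'a list \<Rightarrow> rat) module" where
  "cycle_space K i =
     \<lparr>carrier = simplicial_cycles K i, mult = undefined, one = undefined,
      zero = (\<lambda>_. 0), add = (\<lambda>c d xs. c xs + d xs), smult = (\<lambda>r c xs. r * c xs)\<rparr>"

text \<open>
  Adding \<open>N\<close> in the scalar multiplication only matters for the scalar \<open>0\<close>, where the image of a
  coset is \<open>{0}\<close>.
\<close>

definition quot_module :: "('r, 'm, 'x) module_scheme \<Rightarrow> 'm set \<Rightarrow> ('r, 'm set) module" where
  "quot_module M N =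
     \<lparr>carrier = a_rcosets\<^bsub>M\<^esub> N, mult = undefined, one = undefined,
      zero = N, add = set_add M, smult = (\<lambda>r A. N <+>\<^bsub>M\<^esub> (\<lambda>x. r \<odot>\<^bsub>M\<^esub> x) ` A)\<rparr>"

definition reduced_homology :: "'a set set \<Rightarrow> int \<Rightarrow> (rat, ('a list \<Rightarrow> rat) set) module" where
  "reduced_homology K i = quot_module (cycle_space K i) (simplicial_boundaries K i)"

definition reduced_betti :: "'a set set \<Rightarrow> int \<Rightarrow> nat" where
  "reduced_betti K i = vectorspace.dim class_ring (reduced_homology K i)"

text \<open>
  There are no nonzero chains of degree \<open>i\<close> unless \<open>0 \<le> i + 1 \<le> card (pverts G)\<close>.
\<close>

definition total_reduced_betti :: "'a pair_pre_digraph \<Rightarrow> nat" where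
  "total_reduced_betti G =
     (\<Sum>i\<in>{-1..<int (card (pverts G))}. reduced_betti (independence_complex G) i)"


subsection \<open>Well-formedness of the homology spaces\<close>

lemma vectorspace_quot_module:
  assumes V: "vectorspace F V" and W: "subspace F W V"
  shows "vectorspace F (quot_module V W)"
proof -
  interpret V: vectorspace F V by fact
  interpret W: submodule F W V using W by (simp add: subspace_def)
  have neg: "\<ominus>\<^bsub>V\<^esub> w \<in> W" if "w \<in> W" for w
  proof -
    have "(\<ominus>\<^bsub>F\<^esub> \<one>\<^bsub>F\<^esub>) \<odot>\<^bsub>V\<^esub> w \<in> W"
      by (rule W.smult_closed) (use that in simp_all)
    moreover have "(\<ominus>\<^bsub>F\<^esub> \<one>\<^bsub>F\<^esub>) \<odot>\<^bsub>V\<^esub> w = \<ominus>\<^bsub>V\<^esub> w"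
      by (rule V.smult_minus_1) (use that W.subset in blast)
    ultimately show ?thesis by metis
  qed
  have "additive_subgroup W V"
    unfolding additive_subgroup_def
    by (rule subgroup.intro) (use W.subset neg in \<open>auto simp: a_inv_def[symmetric]\<close>)
  then interpret A: abelian_subgroup W V
    by (intro abelian_subgroupI3) (auto simp: V.abelian_group_axioms)
  have coset: "W +>\<^bsub>V\<^esub> x = {w \<oplus>\<^bsub>V\<^esub> x | w. w \<in> W}" for x
    by (auto simp: a_r_coset_def r_coset_def)
  have car: "carrier (quot_module V W) = {W +>\<^bsub>V\<^esub> x | x. x \<in> carrier V}"
    by (auto simp: quot_module_def A_RCOSETS_def RCOSETS_def a_r_coset_def)
  have sm: "r \<odot>\<^bsub>quot_module V W\<^esub> (W +>\<^bsub>V\<^esub> x) = W +>\<^bsub>V\<^esub> (r \<odot>\<^bsub>V\<^esub> x)"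
    if r: "r \<in> carrier F" and x: "x \<in> carrier V" for r x
  proof (intro equalityI subsetI)
    fix y assume "y \<in> r \<odot>\<^bsub>quot_module V W\<^esub> (W +>\<^bsub>V\<^esub> x)"
    then obtain w w' where w: "w \<in> W" "w' \<in> W" "y = w \<oplus>\<^bsub>V\<^esub> r \<odot>\<^bsub>V\<^esub> (w' \<oplus>\<^bsub>V\<^esub> x)"
      by (auto simp: quot_module_def set_add_def set_mult_def coset)
    have "y = (w \<oplus>\<^bsub>V\<^esub> r \<odot>\<^bsub>V\<^esub> w') \<oplus>\<^bsub>V\<^esub> r \<odot>\<^bsub>V\<^esub> x"
      using w r x W.subset by (auto simp: V.smult_r_distr V.M.a_assoc subset_iff)
    then show "y \<in> W +>\<^bsub>V\<^esub> (r \<odot>\<^bsub>V\<^esub> x)"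
      unfolding coset using w r by blast
  next
    fix y assume "y \<in> W +>\<^bsub>V\<^esub> (r \<odot>\<^bsub>V\<^esub> x)"
    then obtain w where w: "w \<in> W" "y = w \<oplus>\<^bsub>V\<^esub> r \<odot>\<^bsub>V\<^esub> x" by (auto simp: coset)
    then have "y = w \<oplus>\<^bsub>V\<^esub> r \<odot>\<^bsub>V\<^esub> (\<zero>\<^bsub>V\<^esub> \<oplus>\<^bsub>V\<^esub> x)" using x by simp
    moreover have "\<zero>\<^bsub>V\<^esub> \<oplus>\<^bsub>V\<^esub> x \<in> W +>\<^bsub>V\<^esub> x" unfolding coset using W.zero_closed by blast
    ultimately show "y \<in> r \<odot>\<^bsub>quot_module V W\<^esub> (W +>\<^bsub>V\<^esub> x)"
      using w(1) by (auto simp: quot_module_def set_add_def set_mult_def)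
  qed
  have ad: "(W +>\<^bsub>V\<^esub> x) \<oplus>\<^bsub>quot_module V W\<^esub> (W +>\<^bsub>V\<^esub> y) = W +>\<^bsub>V\<^esub> (x \<oplus>\<^bsub>V\<^esub> y)"
    if "x \<in> carrier V" "y \<in> carrier V" for x y
    using that A.a_rcos_sum by (simp add: quot_module_def)
  have zr: "\<zero>\<^bsub>quot_module V W\<^esub> = W +>\<^bsub>V\<^esub> \<zero>\<^bsub>V\<^esub>"
    using W.subset by (simp add: quot_module_def)
  have carI: "W +>\<^bsub>V\<^esub> x \<in> carrier (quot_module V W)" if "x \<in> carrier V" for x
    using that unfolding car by blast
  have carE: thesis if "A \<in> carrier (quot_module V W)"
    "\<And>x. x \<in> carrier V \<Longrightarrow> A = W +>\<^bsub>V\<^esub> x \<Longrightarrow> thesis" for A thesis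
    using that unfolding car by blast
  have ab: "abelian_group (quot_module V W)"
  proof (rule abelian_groupI)
    fix A assume "A \<in> carrier (quot_module V W)"
    then obtain x where x: "x \<in> carrier V" "A = W +>\<^bsub>V\<^esub> x" by (auto simp: car)
    then have "(W +>\<^bsub>V\<^esub> (\<ominus>\<^bsub>V\<^esub> x)) \<oplus>\<^bsub>quot_module V W\<^esub> A = \<zero>\<^bsub>quot_module V W\<^esub>"
      by (simp add: ad zr V.M.l_neg)
    moreover have "W +>\<^bsub>V\<^esub> (\<ominus>\<^bsub>V\<^esub> x) \<in> carrier (quot_module V W)" using x by (auto simp: car)
    ultimately show "\<exists>B\<in>carrier (quot_module V W).
        B \<oplus>\<^bsub>quot_module V W\<^esub> A = \<zero>\<^bsub>quot_module V W\<^esub>" by blast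
  qed (auto elim!: carE intro!: carI simp: ad zr V.M.a_ac)
  have "module F (quot_module V W)"
  proof (rule moduleI)
    show "cring F" by (rule V.R.is_cring)
    show "abelian_group (quot_module V W)" by (rule ab)
  qed (auto elim!: carE intro!: carI
      simp: sm ad V.smult_l_distr V.smult_r_distr V.smult_assoc1)
  then show ?thesis
    by (simp add: vectorspace_def V.field_axioms)
qed

lemma simplicial_boundary_mem_chains:
  assumes "\<And>S T. S \<in> K \<Longrightarrow> T \<subseteq> S \<Longrightarrow> T \<in> K" and c: "c \<in> simplicial_chains K i"
  shows "simplicial_boundary K c \<in> simplicial_chains K (i - 1)"
proof -
  have "distinct xs \<and> set xs \<in> K \<and> int (length xs) = i - 1 + 1"
    if nz: "simplicial_boundary K c xs \<noteq> 0" for xs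
  proof -
    obtain v where "c (v # xs) \<noteq> 0"
      using sum.not_neutral_contains_not_neutral[OF nz[unfolded simplicial_boundary_def]] by blast
    then have "distinct (v # xs) \<and> set (v # xs) \<in> K \<and> int (length (v # xs)) = i + 1"
      using c unfolding simplicial_chains_def by blast
    then show ?thesis using assms(1)[of "set (v # xs)" "set xs"] by auto
  qed
  moreover have "simplicial_boundary K c (xs @ v # u # ys) = - simplicial_boundary K c (xs @ u # v # ys)"
    for xs u v ys
  proof -
    have "c ((w # xs) @ v # u # ys) = - c ((w # xs) @ u # v # ys)" for w
      using c unfolding simplicial_chains_def by blast
    then have "simplicial_boundary K c (xs @ v # u # ys) =
        (\<Sum>w\<in>\<Union>K. - c ((w # xs) @ u # v # ys))"
      unfolding simplicial_boundary_def append_Cons by (intro sum.cong refl)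
    then show ?thesis by (simp add: simplicial_boundary_def sum_negf)
  qed
  ultimately show ?thesis unfolding simplicial_chains_def by blast
qed

lemma boundary_boundary:
  assumes c: "c \<in> simplicial_chains K i"
  shows "simplicial_boundary K (simplicial_boundary K c) = (\<lambda>_. 0)"
proof
  fix xs
  have "c ([] @ v # u # xs) = - c ([] @ u # v # xs)" for u v
    using c unfolding simplicial_chains_def by blast
  then have swap: "c (v # u # xs) = - c (u # v # xs)" for u v
    unfolding append_Nil .
  have "simplicial_boundary K (simplicial_boundary K c) xs = (\<Sum>u\<in>\<Union>K. \<Sum>v\<in>\<Union>K. c (v # u # xs))"
    by (simp add: simplicial_boundary_def)
  also have "\<dots> = (\<Sum>v\<in>\<Union>K. \<Sum>u\<in>\<Union>K. c (v # u # xs))" by (rule sum.swap)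
  also have "\<dots> = (\<Sum>v\<in>\<Union>K. \<Sum>u\<in>\<Union>K. - c (u # v # xs))"
    by (intro sum.cong refl swap)
  also have "\<dots> = - simplicial_boundary K (simplicial_boundary K c) xs"
    by (simp add: simplicial_boundary_def sum_negf)
  finally show "simplicial_boundary K (simplicial_boundary K c) xs = 0" by simp
qed

lemma chains_linear:
  "(\<lambda>_. 0) \<in> simplicial_chains K i"
  "c \<in> simplicial_chains K i \<Longrightarrow> d \<in> simplicial_chains K i \<Longrightarrow>
    (\<lambda>xs. c xs + d xs) \<in> simplicial_chains K i"
  "c \<in> simplicial_chains K i \<Longrightarrow> (\<lambda>xs. r * c xs) \<in> simplicial_chains K i"
proof -
  have supp: "distinct xs \<and> set xs \<in> K \<and> int (length xs) = i + 1"
    if "c \<in> simplicial_chains K i" "c xs \<noteq> 0" for c xs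
    using that unfolding simplicial_chains_def by blast
  have swap: "c (xs @ v # u # ys) = - c (xs @ u # v # ys)"
    if "c \<in> simplicial_chains K i" for c xs u v ys
    using that unfolding simplicial_chains_def by blast
  show "(\<lambda>_. 0) \<in> simplicial_chains K i" by (simp add: simplicial_chains_def)
  show "(\<lambda>xs. c xs + d xs) \<in> simplicial_chains K i"
    if c: "c \<in> simplicial_chains K i" and d: "d \<in> simplicial_chains K i"
    unfolding simplicial_chains_def mem_Collect_eq
  proof (intro conjI allI impI)
    fix xs u v ys
    show "c (xs @ v # u # ys) + d (xs @ v # u # ys) = - (c (xs @ u # v # ys) + d (xs @ u # v # ys))"
      unfolding swap[OF c, of xs u v] swap[OF d, of xs u v] by simp
  next
    fix xs assume "c xs + d xs \<noteq> 0"
    then have "c xs \<noteq> 0 \<or> d xs \<noteq> 0" by auto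
    with supp[OF c] supp[OF d]
    show "distinct xs" "set xs \<in> K" "int (length xs) = i + 1" by blast+
  qed
  show "(\<lambda>xs. r * c xs) \<in> simplicial_chains K i" if c: "c \<in> simplicial_chains K i"
    unfolding simplicial_chains_def mem_Collect_eq
  proof (intro conjI allI impI)
    fix xs u v ys
    show "r * c (xs @ v # u # ys) = - (r * c (xs @ u # v # ys))"
      unfolding swap[OF c, of xs u v] by simp
  next
    fix xs assume "r * c xs \<noteq> 0"
    then have "c xs \<noteq> 0" by auto
    with supp[OF c]
    show "distinct xs" "set xs \<in> K" "int (length xs) = i + 1" by blast+
  qed
qed

lemma boundary_linear:
  "simplicial_boundary K (\<lambda>_. 0) = (\<lambda>_. 0)"
  "simplicial_boundary K (\<lambda>xs. c xs + d xs) = (\<lambda>xs. simplicial_boundary K c xs + simplicial_boundary K d xs)"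
  "simplicial_boundary K (\<lambda>xs. r * c xs) = (\<lambda>xs. r * simplicial_boundary K c xs)"
  by (simp_all add: simplicial_boundary_def sum.distrib sum_distrib_left)

lemma vectorspace_cycle_space: "vectorspace class_ring (cycle_space K i)"
proof -
  have lin: "(\<lambda>_. 0) \<in> simplicial_cycles K i"
    "c \<in> simplicial_cycles K i \<Longrightarrow> d \<in> simplicial_cycles K i \<Longrightarrow> (\<lambda>xs. c xs + d xs) \<in> simplicial_cycles K i"
    "c \<in> simplicial_cycles K i \<Longrightarrow> (\<lambda>xs. r * c xs) \<in> simplicial_cycles K i" for c d r
    by (auto simp: simplicial_cycles_def chains_linear boundary_linear)
  have "abelian_group (cycle_space K i)"
  proof (rule abelian_groupI)
    fix c assume "c \<in> carrier (cycle_space K i)"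
    then show "\<exists>d\<in>carrier (cycle_space K i). d \<oplus>\<^bsub>cycle_space K i\<^esub> c = \<zero>\<^bsub>cycle_space K i\<^esub>"
      using lin(3)[of c "-1"] by (intro bexI[of _ "\<lambda>xs. -1 * c xs"]) (auto simp: cycle_space_def)
  qed (auto simp: cycle_space_def lin algebra_simps)
  moreover have "cring (class_ring :: rat ring)" "field (class_ring :: rat ring)"
    using class_field by (auto simp: field_def domain_def)
  ultimately show ?thesis
    unfolding vectorspace_def
    by (auto intro!: moduleI simp: cycle_space_def lin algebra_simps class_ring_simps)
qed

lemma vectorspace_reduced_homology:
  assumes "\<And>S T. S \<in> K \<Longrightarrow> T \<subseteq> S \<Longrightarrow> T \<in> K"
  shows "vectorspace class_ring (reduced_homology K i)"
  unfolding reduced_homology_def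
proof (rule vectorspace_quot_module[OF vectorspace_cycle_space])
  have sub: "simplicial_boundaries K i \<subseteq> simplicial_cycles K i"
    using simplicial_boundary_mem_chains[OF assms] boundary_boundary
    by (fastforce simp: simplicial_boundaries_def simplicial_cycles_def)
  have lin: "(\<lambda>_. 0) \<in> simplicial_boundaries K i"
    "c \<in> simplicial_boundaries K i \<Longrightarrow> d \<in> simplicial_boundaries K i \<Longrightarrow>
      (\<lambda>xs. c xs + d xs) \<in> simplicial_boundaries K i"
    "c \<in> simplicial_boundaries K i \<Longrightarrow> (\<lambda>xs. r * c xs) \<in> simplicial_boundaries K i" for c d r
    unfolding simplicial_boundaries_def
    subgoal by (rule image_eqI[OF _ chains_linear(1)]) (simp add: boundary_linear)
    subgoal by (auto simp: boundary_linear intro!: image_eqI[OF _ chains_linear(2)])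
    subgoal by (auto simp: boundary_linear intro!: image_eqI[OF _ chains_linear(3)])
    done
  interpret vectorspace class_ring "cycle_space K i" by (rule vectorspace_cycle_space)
  show "subspace class_ring (simplicial_boundaries K i) (cycle_space K i)"
    using sub lin
    by (intro subspace.intro submodule.intro vectorspace_cycle_space module_axioms)
       (auto simp: cycle_space_def)
qed

lemma independence_complex_closed:
  "S \<in> independence_complex G \<Longrightarrow> T \<subseteq> S \<Longrightarrow> T \<in> independence_complex G"
  by (auto simp: independence_complex_def)

end

theory Submission
  imports Defs "Jordan_Normal_Form.DL_Rank"
begin

text \<open>
  Take a graph of minimal order that violates the bound. Every proper induced subgraph \<open>W\<close> then
  has homology of total dimension at most one, so it is described by a single degree (or by its
  vanishing), and the exact sequence relating \<open>W\<close>, \<open>W - v\<close> and \<open>W - N[v]\<close> turns into a rule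
  for these degrees. For the whole graph \<open>V\<close>, both \<open>V - v\<close> and \<open>V - N[v]\<close> must have
  nonvanishing homology, for every \<open>v\<close>. Call \<open>u\<close> and \<open>v\<close> similar if they are equal or the
  homology of \<open>V - {u, v}\<close> does not vanish. Comparing degrees shows that similarity is an
  equivalence relation, that adjacent vertices are not similar, that the neighbours of a vertex
  are never all similar, and that of any two edges, some end of one is similar to some end of the
  other. Therefore there are exactly three classes, and each vertex has neighbours in the two
  others. Orient the edges cyclically between the classes: a shortest directed cycle is induced,
  and its length is divisible by three.
\<close>

section \<open>Induced cycles in three-coloured graphs\<close>

lemma mod_3_successor_cases:
  fixes m n :: nat
  assumes "m < 3" "n < 3" "m \<noteq> n"
  shows "n = Suc m mod 3 \<or> m = Suc n mod 3"
  using assms by presburger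

lemma mod_3_successor_exhaust:
  fixes k m n :: nat
  assumes "k < 3" "m < 3" "n < 3" "k \<noteq> m" "k \<noteq> n" "m \<noteq> n"
  shows "m = Suc k mod 3 \<or> n = Suc k mod 3"
  using assms by presburger

text \<open>Iterating a choice of successors inside the finite set \<open>V\<close> must repeat a
  value; the walk starts at the earlier of two equal values.\<close>

lemma directed_closed_walk_exists:
  fixes A :: "('a \<times> 'a) set"
  assumes "finite V" "V \<noteq> {}" and out: "\<And>v. v \<in> V \<Longrightarrow> \<exists>w\<in>V. (v, w) \<in> A"
  obtains n g where "0 < n" "g n = g 0" "\<And>k. g k \<in> V" "\<And>k. (g k, g (Suc k)) \<in> A"
proof -
  obtain v where v: "v \<in> V" using assms by blast
  obtain s where s: "\<And>v. v \<in> V \<Longrightarrow> s v \<in> V \<and> (v, s v) \<in> A" using out by metis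
  define g where "g k = (s ^^ k) v" for k
  have gV: "g k \<in> V" for k by (induction k) (auto simp: g_def v s)
  then have "\<not> inj g"
    using \<open>finite V\<close> by (meson finite_subset image_subsetI infinite_UNIV_nat finite_imageD)
  then obtain i j where ij: "i < j" "g i = g j" by (metis injI linorder_neqE_nat)
  show thesis
    by (rule that[of "j - i" "\<lambda>k. g (i + k)"]) (use ij gV s in \<open>auto simp: g_def\<close>)
qed

text \<open>
  Among the closed walks that follow the orientation \<open>0 \<rightarrow> 1 \<rightarrow> 2 \<rightarrow> 0\<close> of the edges, a shortest
  one has no chord, as each chord is oriented and shortcuts the walk in its own direction.
\<close>

lemma three_coloured_induced_cycle:
  fixes E :: "('a \<times> 'a) set" and c :: "'a \<Rightarrow> nat"
  assumes fin: "finite V" "V \<noteq> {}" and sym: "\<And>u v. (u, v) \<in> E \<Longrightarrow> (v, u) \<in> E"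
    and c3: "\<And>v. v \<in> V \<Longrightarrow> c v < 3"
    and proper: "\<And>u v. u \<in> V \<Longrightarrow> v \<in> V \<Longrightarrow> (u, v) \<in> E \<Longrightarrow> c u \<noteq> c v"
    and out: "\<And>v. v \<in> V \<Longrightarrow> \<exists>w\<in>V. (v, w) \<in> E \<and> c w = Suc (c v) mod 3"
  obtains vs where "3 \<le> length vs" "3 dvd length vs" "distinct vs" "set vs \<subseteq> V"
    "\<And>i j. i < length vs \<Longrightarrow> j < length vs \<Longrightarrow>
       (vs ! i, vs ! j) \<in> E \<longleftrightarrow> j = Suc i mod length vs \<or> i = Suc j mod length vs"
proof -
  define A where "A = {(u, v). u \<in> V \<and> v \<in> V \<and> (u, v) \<in> E \<and> c v = Suc (c u) mod 3}"
  \<comment> \<open>A closed directed walk of \<open>n\<close> steps. Only the values up to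
    \<open>n\<close> are constrained, so walks can be spliced by an \<open>if\<close>.\<close>
  define cw where "cw n g \<longleftrightarrow> 0 < n \<and> g n = g 0 \<and> (\<forall>k<n. (g k, g (Suc k)) \<in> A)" for n and g :: "nat \<Rightarrow> 'a"
  have "\<exists>n g. cw n g"
    using directed_closed_walk_exists[OF fin, of A] out unfolding cw_def A_def by auto metis
  then obtain n where "\<exists>g. cw n g" and "\<And>m g. cw m g \<Longrightarrow> n \<le> m"
    using exists_least_iff[of "\<lambda>n. \<exists>g. cw n g"] by (metis not_less)
  then obtain g where g: "0 < n" "g n = g 0" "\<And>k. k < n \<Longrightarrow> (g k, g (Suc k)) \<in> A"
    and min: "\<And>m g. cw m g \<Longrightarrow> n \<le> m" unfolding cw_def by blast
  have gV: "g k \<in> V" if "k < n" for k using g(3)[OF that] by (auto simp: A_def)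
  have col: "c (g k) = (c (g 0) + k) mod 3" if "k \<le> n" for k
    using that
  proof (induction k)
    case 0
    then show ?case using c3[OF gV[OF g(1)]] by simp
  next
    case (Suc k)
    then have "c (g (Suc k)) = Suc (c (g k)) mod 3" using g(3)[of k] by (auto simp: A_def)
    then show ?case using Suc by (simp add: mod_Suc_eq)
  qed
  \<comment> \<open>Each step raises the colour by one modulo 3, so closing up after
    \<open>n\<close> steps makes \<open>n\<close> divisible by 3.\<close>
  have "(c (g 0) + n) mod 3 = c (g 0)" using col[of n] g(2) by simp
  then have n3: "3 dvd n" using c3[OF gV[OF g(1)]] by presburger
  have forward: "j = Suc i mod n" if "i < n" "j < n" "(g i, g j) \<in> A" for i j
  proof (cases "j \<le> i")
    case True
    \<comment> \<open>The chord closes the stretch from \<open>g j\<close> to \<open>g i\<close>;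
      minimality leaves only \<open>j = 0\<close> and \<open>i = n - 1\<close>.\<close>
    have "cw (Suc (i - j)) (\<lambda>k. if k \<le> i - j then g (j + k) else g j)"
      unfolding cw_def using that True g(3) by (auto simp: not_le less_Suc_eq_le le_less_Suc_eq)
    from min[OF this] show ?thesis using that True by (cases "i = n - 1") auto
  next
    case False
    \<comment> \<open>The chord skips the vertices strictly between \<open>g i\<close> and
      \<open>g j\<close>; minimality leaves only \<open>j = i + 1\<close>.\<close>
    have "cw (Suc i + (n - j)) (\<lambda>k. if k \<le> i then g k else g (k - Suc i + j))"
      unfolding cw_def
    proof (intro conjI allI impI)
      fix k assume k: "k < Suc i + (n - j)"
      consider "k < i" | "k = i" | "k > i" by linarith
      then show "(if k \<le> i then g k else g (k - Suc i + j),
          if Suc k \<le> i then g (Suc k) else g (Suc k - Suc i + j)) \<in> A"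
      proof cases
        case 3
        then have "Suc k - Suc i + j = Suc (k - Suc i + j)" by simp
        with 3 k that False show ?thesis using g(3)[of "k - Suc i + j"] by simp
      qed (use that g(3)[of k] in auto)
    qed (use that False g(2) in auto)
    from min[OF this] show ?thesis using that False by simp
  qed
  have inj: "i = j" if "i < n" "j < n" "g i = g j" for i j
  proof -
    have "\<not> i < j" if "j < n" "g i = g j" for i j
    proof
      assume "i < j"
      \<comment> \<open>A repeated vertex would cut off a shorter closed walk.\<close>
      then have "cw (j - i) (\<lambda>k. g (i + k))" unfolding cw_def using that g(3) by auto
      from min[OF this] show False using that \<open>i < j\<close> by simp
    qed
    then show ?thesis using that by (metis linorder_neqE_nat)
  qed
  have arc: "(g i, g (Suc i mod n)) \<in> A" if "i < n" for i
  proof (cases "Suc i = n")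
    case True
    then have "Suc i mod n = 0" by simp
    then show ?thesis using g(3)[OF that] unfolding True g(2) by simp
  next
    case False
    then have "Suc i mod n = Suc i" using that by simp
    then show ?thesis using g(3)[OF that] by simp
  qed
  define vs where "vs = map g [0..<n]"
  have A_or: "(u, v) \<in> A \<or> (v, u) \<in> A" if "u \<in> V" "v \<in> V" "(u, v) \<in> E" for u v
  proof -
    have "c v = Suc (c u) mod 3 \<or> c u = Suc (c v) mod 3"
      using mod_3_successor_cases c3[OF that(1)] c3[OF that(2)] proper[OF that] by blast
    then show ?thesis using that sym[OF that(3)] by (auto simp: A_def)
  qed
  show thesis
  proof (rule that[of vs])
    show "(vs ! i, vs ! j) \<in> E \<longleftrightarrow> j = Suc i mod length vs \<or> i = Suc j mod length vs"
      if "i < length vs" "j < length vs" for i j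
    proof -
      have ij: "i < n" "j < n" using that by (auto simp: vs_def)
      have "(g i, g j) \<in> E \<longleftrightarrow> j = Suc i mod n \<or> i = Suc j mod n"
      proof
        assume "(g i, g j) \<in> E"
        from A_or[OF gV[OF ij(1)] gV[OF ij(2)] this] show "j = Suc i mod n \<or> i = Suc j mod n"
          using forward ij by blast
      next
        assume "j = Suc i mod n \<or> i = Suc j mod n"
        then show "(g i, g j) \<in> E" using arc[of i] arc[of j] ij sym unfolding A_def by blast
      qed
      then show ?thesis using ij by (simp add: vs_def)
    qed
    show "3 \<le> length vs" "3 dvd length vs" using n3 g(1) by (auto simp: vs_def dest: dvd_imp_le)
    show "distinct vs" using inj by (auto simp: vs_def distinct_map inj_on_def)
    show "set vs \<subseteq> V" using gV by (auto simp: vs_def)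
  qed
qed


section \<open>Degrees in a critical graph\<close>

text \<open>
  The degrees allowed by exactness for a graph, its subgraph without \<open>v\<close>, and its subgraph
  without the closed neighbourhood of \<open>v\<close>.
\<close>

definition exact_degrees :: "int option \<Rightarrow> int option \<Rightarrow> int option \<Rightarrow> bool" where
  "exact_degrees x y z \<longleftrightarrow>
     x = None \<and> y = z \<or>
     y = None \<and> x = map_option (\<lambda>d. d + 1) z \<or>
     z = None \<and> x = y"

lemma exact_degrees_simps [simp]:
  "exact_degrees None y z \<longleftrightarrow> y = z"
  "exact_degrees x y None \<longleftrightarrow> x = y"
  "exact_degrees (Some d) None z \<longleftrightarrow> z = Some (d - 1)"
  "exact_degrees (Some d) (Some e) z \<longleftrightarrow> d = e \<and> z = None"
  "exact_degrees (Some d) y (Some e) \<longleftrightarrow> y = None \<and> d = e + 1"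
  "exact_degrees x (Some d) (Some e) \<longleftrightarrow> d = e \<and> x = None"
  by (cases x; cases y; cases z; force simp: exact_degrees_def)+

text \<open>
  \<open>deg W\<close> is the degree in which the subgraph induced by \<open>W\<close> has its one-dimensional
  homology, \<open>None\<close> if the homology vanishes; it carries no information for \<open>W = V\<close>.
\<close>

locale critical_graph =
  fixes V :: "'a set" and E :: "('a \<times> 'a) set" and deg :: "'a set \<Rightarrow> int option"
  assumes finite_V: "finite V" and V_nonempty: "V \<noteq> {}"
    and sym: "(u, v) \<in> E \<Longrightarrow> (v, u) \<in> E" and irrefl: "(u, u) \<notin> E"
    and not_isolated: "v \<in> V \<Longrightarrow> \<exists>u\<in>V. (v, u) \<in> E"
    and exact: "W \<subset> V \<Longrightarrow> v \<in> W \<Longrightarrow>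
      exact_degrees (deg W) (deg (W - {v})) (deg (W - insert v {u. (v, u) \<in> E}))"
    and critical: "v \<in> V \<Longrightarrow>
      deg (V - {v}) \<noteq> None \<and> deg (V - insert v {u. (v, u) \<in> E}) \<noteq> None"
begin

section \<open>Degrees after removing vertices and closed neighbourhoods\<close>

definition nbs :: "'a set \<Rightarrow> 'a set" where
  "nbs X = {u. \<exists>x\<in>X. (x, u) \<in> E}"

text \<open>The degree of \<open>V - N[X] - Y\<close>, where \<open>N[X]\<close> is the closed neighbourhood.\<close>

definition dg :: "'a set \<Rightarrow> 'a set \<Rightarrow> int option" where
  "dg X Y = deg (V - X - nbs X - Y)"

text \<open>Removing \<open>v\<close> enlarges \<open>Y\<close>, removing its closed neighbourhood
  enlarges \<open>X\<close>. As \<open>X \<union> Y\<close> is nonempty, the subgraph is proper and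
  \<open>exact\<close> applies.\<close>

lemma dg_exact:
  assumes "X \<subseteq> V" "Y \<subseteq> V" "X \<union> Y \<noteq> {}" "v \<in> V" "v \<notin> X" "v \<notin> nbs X" "v \<notin> Y"
  shows "exact_degrees (dg X Y) (dg X (insert v Y)) (dg (insert v X) Y)"
proof -
  have "V - X - nbs X - Y \<subset> V" using assms by blast
  moreover have "V - X - nbs X - insert v Y = V - X - nbs X - Y - {v}"
    "V - insert v X - nbs (insert v X) - Y = V - X - nbs X - Y - insert v {u. (v, u) \<in> E}"
    by (auto simp: nbs_def)
  ultimately show ?thesis using exact[of "V - X - nbs X - Y" v] assms unfolding dg_def by simp
qed

lemma dg_nbs: "v \<in> nbs X \<Longrightarrow> dg X (insert v Y) = dg X Y"
  unfolding dg_def by (rule arg_cong[of _ _ deg]) auto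

text \<open>
  The second degree is shifted so that \<open>V - {v}\<close> and \<open>V - N[v]\<close> contribute to the homology
  of \<open>V\<close> in the degrees \<open>del_deg v\<close> and \<open>link_deg v\<close>.
\<close>

definition del_deg where "del_deg v = the (dg {} {v})"
definition link_deg where "link_deg v = the (dg {v} {}) + 1"

lemma deg_vertex:
  assumes "v \<in> V"
  shows "dg {} {v} = Some (del_deg v)" "dg {v} {} = Some (link_deg v - 1)"
proof -
  have "V - {} - nbs {} - {v} = V - {v}" "V - {v} - nbs {v} - {} = V - insert v {u. (v, u) \<in> E}"
    by (auto simp: nbs_def)
  then have "dg {} {v} = deg (V - {v})" "dg {v} {} = deg (V - insert v {u. (v, u) \<in> E})"
    by (simp_all only: dg_def)
  with critical[OF assms] show "dg {} {v} = Some (del_deg v)" "dg {v} {} = Some (link_deg v - 1)"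
    by (auto simp: del_deg_def link_deg_def)
qed

section \<open>Similarity and its effect on the degrees\<close>

definition sim where "sim u v \<longleftrightarrow> u = v \<or> dg {} {u, v} \<noteq> None"

lemma sim_sym: "sim u v \<Longrightarrow> sim v u"
  by (auto simp: sim_def insert_commute)

text \<open>Since \<open>v\<close> is a neighbour of \<open>u\<close>, the term
  \<open>dg {u} {v}\<close> equals \<open>dg {u} {}\<close>, which does not vanish; nor does
  \<open>dg {} {v}\<close>. Exactness then forces the middle term \<open>dg {} {u, v}\<close> to
  vanish.\<close>

lemma edge_not_sim:
  assumes "u \<in> V" "v \<in> V" "(u, v) \<in> E"
  shows "\<not> sim u v"
proof -
  have "exact_degrees (dg {} {v}) (dg {} {u, v}) (dg {u} {v})"
    using assms irrefl by (intro dg_exact) (auto simp: nbs_def)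
  moreover have "dg {u} {v} = dg {u} {}" using assms by (intro dg_nbs) (auto simp: nbs_def)
  ultimately show ?thesis
    using deg_vertex[OF assms(1)] deg_vertex[OF assms(2)] assms irrefl by (auto simp: sim_def)
qed

lemma dg_pair_exact:
  assumes "u \<in> V" "v \<in> V" "u \<noteq> v"
  shows "exact_degrees (dg {} {v}) (dg {} {u, v}) (dg {u} {v})"
  using assms irrefl by (intro dg_exact) (auto simp: nbs_def)

text \<open>If \<open>dg {} {u, v}\<close> does not vanish, it shares its degree with
  \<open>V - {u}\<close> and \<open>V - {v}\<close>, and \<open>dg {u} {v}\<close> vanishes.
  Exactness for the closed neighbourhoods then compares both link degrees with
  \<open>dg {u, v} {}\<close>.\<close>

lemma simD:
  assumes "u \<in> V" "v \<in> V" "u \<noteq> v" "sim u v"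
  shows "dg {} {u, v} = Some (del_deg u)" "dg {u} {v} = None" "dg {u, v} {} = Some (link_deg u - 2)"
    "del_deg u = del_deg v" "link_deg u = link_deg v"
proof -
  have nE: "(u, v) \<notin> E" "(v, u) \<notin> E" using edge_not_sim assms sim_sym by blast+
  note r = dg_pair_exact[of u v] dg_pair_exact[of v u]
  have s: "exact_degrees (dg {u} {}) (dg {u} {v}) (dg {u, v} {})" "exact_degrees (dg {v} {}) (dg {v} {u}) (dg {u, v} {})"
    using dg_exact[of "{u}" "{}" v] dg_exact[of "{v}" "{}" u] assms nE by (auto simp: nbs_def insert_commute)
  show "dg {} {u, v} = Some (del_deg u)" "dg {u} {v} = None" "dg {u, v} {} = Some (link_deg u - 2)"
    "del_deg u = del_deg v" "link_deg u = link_deg v"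
    using r s assms deg_vertex[of u] deg_vertex[of v]
    by (auto simp: sim_def insert_commute)
qed

text \<open>If \<open>dg {} {u, v}\<close> vanishes, \<open>dg {u} {v}\<close> has degree
  \<open>del_deg v - 1\<close>. Comparison with \<open>dg {u} {}\<close>, by equality for adjacent
  vertices and by exactness otherwise, shows that dissimilar vertices swap deletion and link
  degrees.\<close>

lemma not_simD:
  assumes "u \<in> V" "v \<in> V" "\<not> sim u v"
  shows "dg {} {u, v} = None" "dg {u} {v} = Some (del_deg v - 1)" "del_deg u = link_deg v" "link_deg u = del_deg v"
    "(u, v) \<notin> E \<Longrightarrow> dg {u, v} {} = None"
proof -
  have uv: "u \<noteq> v" "dg {} {u, v} = None" using assms by (auto simp: sim_def)
  then show "dg {} {u, v} = None" by simp
  note r = dg_pair_exact[of u v] dg_pair_exact[of v u]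
  have r1: "dg {u} {v} = Some (del_deg v - 1)" "dg {v} {u} = Some (del_deg u - 1)"
    using r uv assms deg_vertex[of u] deg_vertex[of v] by (auto simp: insert_commute)
  then show "dg {u} {v} = Some (del_deg v - 1)" by simp
  have *: "link_deg u = del_deg v \<and> del_deg u = link_deg v \<and> ((u, v) \<notin> E \<longrightarrow> dg {u, v} {} = None)"
  proof (cases "(u, v) \<in> E")
    case True
    then have "dg {u} {v} = dg {u} {}" "dg {v} {u} = dg {v} {}" using sym[OF True] by (auto intro!: dg_nbs simp: nbs_def)
    then show ?thesis using True r1 deg_vertex[of u] deg_vertex[of v] assms by simp
  next
    case False
    then have "(v, u) \<notin> E" using sym by blast
    then have s: "exact_degrees (dg {u} {}) (dg {u} {v}) (dg {u, v} {})" "exact_degrees (dg {v} {}) (dg {v} {u}) (dg {u, v} {})"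
      using dg_exact[of "{u}" "{}" v] dg_exact[of "{v}" "{}" u] assms False uv by (auto simp: nbs_def insert_commute)
    then show ?thesis using r1 deg_vertex[of u] deg_vertex[of v] assms uv
      by auto
  qed
  then show "del_deg u = link_deg v" "link_deg u = del_deg v" "(u, v) \<notin> E \<Longrightarrow> dg {u, v} {} = None" by auto
qed


text \<open>In a counterexample similarity equates the degrees of \<open>u\<close>,
  \<open>v\<close>, \<open>w\<close>, and dissimilarity of \<open>u\<close> and \<open>w\<close>
  then equates \<open>del_deg\<close> with \<open>link_deg\<close>. Whether or not
  \<open>dg {} {u, v, w}\<close> vanishes, exactness demands a gap of two between these degrees, or
  nonvanishing of a term known to vanish.\<close>

lemma sim_trans:
  assumes V: "u \<in> V" "v \<in> V" "w \<in> V" and uv: "sim u v" and vw: "sim v w"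
  shows "sim u w"
proof (rule ccontr)
  assume uw: "\<not> sim u w"
  then have ne: "u \<noteq> v" "v \<noteq> w" "u \<noteq> w" using uv vw by (auto simp: sim_def)
  have nE: "(u, v) \<notin> E" "(v, u) \<notin> E" "(v, w) \<notin> E" "(w, v) \<notin> E"
    using edge_not_sim V uv vw sim_sym by blast+
  note uvD = simD[OF V(1,2) ne(1) uv] and vuD = simD[OF V(2,1) ne(1)[symmetric] sim_sym[OF uv]]
    and vwD = simD[OF V(2,3) ne(2) vw] and wvD = simD[OF V(3,2) ne(2)[symmetric] sim_sym[OF vw]]
    and uwD = not_simD[OF V(1,3) uw]
  have 1: "exact_degrees (dg {} {u, w}) (dg {} {u, v, w}) (dg {v} {u, w})"
    using dg_exact[of "{}" "{u, w}" v] V ne by (simp add: nbs_def insert_commute)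
  have 2: "exact_degrees (dg {} {u, v}) (dg {} {u, v, w}) (dg {w} {u, v})"
    using dg_exact[of "{}" "{u, v}" w] V ne by (simp add: nbs_def insert_commute)
  have 3: "exact_degrees (dg {v} {u}) (dg {v} {u, w}) (dg {v, w} {u})"
    using dg_exact[of "{v}" "{u}" w] V ne nE by (simp add: nbs_def insert_commute)
  show False
  proof (cases "dg {} {u, v, w}")
    case None
    then have a: "dg {w} {u, v} = Some (del_deg u - 1)" using 2 uvD by simp
    show False
    proof (cases "(u, w) \<in> E")
      case True
      then have "dg {w} {u, v} = dg {w} {v}" using sym by (intro dg_nbs) (auto simp: nbs_def)
      then show False using a wvD by simp
    next
      case False
      then have nE': "(w, u) \<notin> E" using sym by blast
      have 4: "exact_degrees (dg {w} {v}) (dg {w} {u, v}) (dg {u, w} {v})"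
        using dg_exact[of "{w}" "{v}" u] V ne nE nE' by (simp add: nbs_def insert_commute)
      have 5: "exact_degrees (dg {u, w} {}) (dg {u, w} {v}) (dg {u, v, w} {})"
        using dg_exact[of "{u, w}" "{}" v] V ne nE by (simp add: nbs_def insert_commute)
      have 6: "exact_degrees (dg {u, v} {}) (dg {u, v} {w}) (dg {u, v, w} {})"
        using dg_exact[of "{u, v}" "{}" w] V ne nE False by (simp add: nbs_def insert_commute)
      have "dg {u, w} {v} = Some (del_deg u - 1)" using 4 a wvD by simp
      then have "dg {u, v, w} {} = Some (del_deg u - 1)" using 5 uwD(5)[OF False] by simp
      \<comment> \<open>Exactness here would give \<open>link_deg u - 2 = del_deg u\<close>.\<close>
      then show False using 6 uvD uwD vwD by simp
    qed
  next
    case (Some d)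
    then have "dg {} {u, v, w} = Some (del_deg u)" using 2 uvD(1) by simp
    then have "dg {v} {u, w} = Some (del_deg u)" using 1 uwD(1) by simp
    then have a: "dg {v, w} {u} = Some (del_deg u)" using 3 vuD(2) by simp
    show False
    proof (cases "(u, w) \<in> E")
      case True
      then have "dg {v, w} {u} = dg {v, w} {}" using sym by (intro dg_nbs) (auto simp: nbs_def)
      then show False using a vwD uvD uwD by simp
    next
      case False
      then have nE': "(w, u) \<notin> E" using sym by blast
      have "exact_degrees (dg {v, w} {}) (dg {v, w} {u}) (dg {u, v, w} {})"
        using dg_exact[of "{v, w}" "{}" u] V ne nE nE' by (simp add: nbs_def insert_commute)
      then show False using a vwD uvD uwD by simp
    qed
  qed
qed

text \<open>
  For a minimal such set \<open>M\<close>, the degree of \<open>V - N[M - {t}]\<close> is reached in two ways: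
  it is \<open>link_deg - (|M| - 1)\<close> by adding the vertices one at a time, and it agrees with the
  degree \<open>del_deg - 1\<close> of \<open>V - N[M - {t}] - {t}\<close>. Hence \<open>link_deg - del_deg = |M| - 2\<close>.
\<close>

lemma sim_class_removal_None:
  assumes T: "T \<subseteq> V" "T \<noteq> {}" and simT: "\<And>s t. s \<in> T \<Longrightarrow> t \<in> T \<Longrightarrow> sim s t"
    and none: "dg {} T = None" and t: "t \<in> T"
  shows "del_deg t < link_deg t"
proof -
  define P where "P M \<longleftrightarrow> M \<subseteq> T \<and> M \<noteq> {} \<and> dg {} M = None" for M
  have "P T" using T none by (simp add: P_def)
  then obtain M where PM: "P M" and min: "\<And>U. U \<subset> M \<Longrightarrow> \<not> P U"
    using finite_subset[OF T(1) finite_V] finite_psubset_induct[of T "\<lambda>T. P T \<longrightarrow> (\<exists>M. P M \<and> (\<forall>U. U \<subset> M \<longrightarrow> \<not> P U))"]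
    by metis
  have MT: "M \<subseteq> T" and MV: "M \<subseteq> V" and Mne: "M \<noteq> {}" and qM: "dg {} M = None"
    using PM T by (auto simp: P_def)
  have finM: "finite M" using MV finite_V finite_subset by blast
  \<comment> \<open>By minimality of \<open>M\<close>, removing a proper nonempty subset leaves
    nonvanishing homology.\<close>
  have some: "dg {} U \<noteq> None" if "U \<subseteq> M" "U \<noteq> {}" "U \<noteq> M" for U
  proof -
    have "U \<subset> M" "U \<subseteq> T" using that MT by auto
    with min[of U] that(2) show ?thesis by (simp add: P_def)
  qed
  have xM: "del_deg u = del_deg t" "link_deg u = link_deg t" if "u \<in> M" for u
  proof -
    have u: "u \<in> T" "u \<in> V" "t \<in> V" using that MT T(1) t by auto
    show "del_deg u = del_deg t" "link_deg u = link_deg t" using simD(4,5)[OF u(2,3) _ simT[OF u(1) t]] by (cases "u = t"; simp)+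
  qed
  have indep: "u \<notin> nbs X" if "u \<in> M" "X \<subseteq> M" for u X
  proof
    assume "u \<in> nbs X"
    then obtain s where s: "s \<in> X" "(s, u) \<in> E" by (auto simp: nbs_def)
    then have "s \<in> T" "u \<in> T" using that MT by auto
    then show False using edge_not_sim[OF _ _ s(2)] simT T(1) by blast
  qed
  have deleted: "dg {} U = Some (del_deg t)" if "finite U" "U \<noteq> {}" "U \<subseteq> M" "U \<noteq> M" for U
    using that
  proof (induction U rule: finite_ne_induct)
    case (singleton u)
    then show ?case using deg_vertex(1)[of u] xM MV by auto
  next
    case (insert u F)
    then have "dg {} F = Some (del_deg t)" by blast
    moreover have "exact_degrees (dg {} F) (dg {} (insert u F)) (dg {u} F)"
      using insert MV by (intro dg_exact) (auto simp: nbs_def)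
    moreover have "dg {} (insert u F) \<noteq> None" using insert by (intro some) auto
    ultimately show ?case by auto
  qed
  \<comment> \<open>While \<open>X\<close> and \<open>Y\<close> do not exhaust \<open>M\<close>, the
    first two terms of each sequence agree, so the third vanishes.\<close>
  have mixed: "dg X Y = None"
    if "finite X" "X \<noteq> {}" "X \<subseteq> M" "Y \<subseteq> M" "Y \<noteq> {}" "X \<inter> Y = {}" "X \<union> Y \<noteq> M" for X Y
    using that
  proof (induction X arbitrary: Y rule: finite_ne_induct)
    case (singleton u)
    have "dg {} Y = Some (del_deg t)" "dg {} (insert u Y) = Some (del_deg t)"
      using singleton finite_subset[OF _ finM] by (auto intro!: deleted)
    moreover have "exact_degrees (dg {} Y) (dg {} (insert u Y)) (dg {u} Y)"
      using singleton MV by (intro dg_exact) (auto simp: nbs_def)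
    ultimately show ?case by simp
  next
    case (insert u F)
    have "dg F Y = None" by (rule insert.IH) (use insert.prems insert.hyps in blast)+
    moreover have "dg F (insert u Y) = None"
      by (rule insert.IH) (use insert.prems insert.hyps in blast)+
    moreover have "exact_degrees (dg F Y) (dg F (insert u Y)) (dg (insert u F) Y)"
      using insert MV indep[of u F] by (intro dg_exact) auto
    ultimately show ?case by simp
  qed
  \<comment> \<open>Each vertex added to \<open>X\<close> lowers the degree by one, because the
    middle term vanishes by \<open>mixed\<close>.\<close>
  have chosen: "dg X {} = Some (link_deg t - int (card X))"
    if "finite X" "X \<noteq> {}" "X \<subseteq> M" "X \<noteq> M" for X
    using that
  proof (induction X rule: finite_ne_induct)
    case (singleton u)
    then show ?case using deg_vertex(2)[of u] xM MV by auto
  next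
    case (insert u F)
    then have "dg F {} = Some (link_deg t - int (card F))" by blast
    moreover have "dg F {u} = None" using insert by (intro mixed) auto
    moreover have "exact_degrees (dg F {}) (dg F {u}) (dg (insert u F) {})"
      using insert MV indep[of u F] by (intro dg_exact) auto
    ultimately show ?case using insert by simp
  qed
  \<comment> \<open>The vanishing of \<open>dg {} M\<close> lowers the degree once. After that,
    moving a vertex from \<open>Y\<close> to \<open>X\<close> keeps the degree, because the first
    term vanishes by \<open>mixed\<close>.\<close>
  have full: "dg X (M - X) = Some (del_deg t - 1)"
    if "finite X" "X \<noteq> {}" "X \<subseteq> M" "X \<noteq> M" for X
    using that
  proof (induction X rule: finite_ne_induct)
    case (singleton u)
    then have "dg {} (M - {u}) = Some (del_deg t)" using finM by (intro deleted) auto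
    moreover have "exact_degrees (dg {} (M - {u})) (dg {} (insert u (M - {u}))) (dg {u} (M - {u}))"
      using singleton MV by (intro dg_exact) (auto simp: nbs_def)
    ultimately show ?case using qM singleton by (simp add: insert_absorb)
  next
    case (insert u F)
    then have "dg F (M - F) = Some (del_deg t - 1)" by blast
    moreover have "insert u (M - insert u F) = M - F" using insert by auto
    moreover have "dg F (M - insert u F) = None" using insert by (intro mixed) auto
    moreover have "exact_degrees (dg F (M - insert u F)) (dg F (insert u (M - insert u F))) (dg (insert u F) (M - insert u F))"
      using insert MV indep[of u F] by (intro dg_exact) auto
    ultimately show ?case by simp
  qed
  \<comment> \<open>\<open>M\<close> has at least three elements: removing one vertex leaves
    nonvanishing homology by \<open>critical\<close>, and removing two by similarity.\<close>
  obtain s where s: "s \<in> M" using Mne by blast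
  have "M \<noteq> {s}" using qM deg_vertex(1)[of s] MV s by auto
  then obtain r where r: "r \<in> M" "r \<noteq> s" using s by blast
  have "M \<noteq> {r, s}" using qM r s simT[of r s] MT by (auto simp: sim_def)
  then obtain p where p: "p \<in> M" "p \<noteq> r" "p \<noteq> s" using r s by blast
  define X where "X = M - {s}"
  have X: "finite X" "X \<noteq> {}" "X \<subseteq> M" "X \<noteq> M" using finM r s by (auto simp: X_def)
  have "{r, p} \<subseteq> X" using r p by (auto simp: X_def)
  from card_mono[OF X(1) this] have "2 \<le> card X" using p by simp
  moreover have "M - X = {s}" "insert s X = M" using s by (auto simp: X_def)
  then have "dg X {s} = Some (del_deg t - 1)" using full[OF X] by simp
  moreover have "exact_degrees (dg X {}) (dg X {s}) (dg (insert s X) {})"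
    using X MV s indep[of s X] by (intro dg_exact) (auto simp: X_def)
  ultimately show ?thesis using chosen[OF X] by simp
qed

section \<open>Neighbourhoods and the coincidence of the two degrees\<close>

lemma nbs_removal_None:
  assumes "v \<in> V"
  shows "dg {} (V \<inter> nbs {v}) = None"
proof -
  define W where "W = V - nbs {v}"
  have "W \<subset> V" using not_isolated[OF assms] by (auto simp: W_def nbs_def)
  moreover have "v \<in> W" using assms irrefl by (auto simp: W_def nbs_def)
  \<comment> \<open>With its neighbours gone \<open>v\<close> is isolated, so both removals give the
    same graph; equal second and third degrees force the first to be \<open>None\<close>.\<close>
  moreover have "W - insert v {u. (v, u) \<in> E} = W - {v}" by (auto simp: W_def nbs_def)
  ultimately have "exact_degrees (deg W) (deg (W - {v})) (deg (W - {v}))"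
    using exact[of W v] by simp
  then have "deg W = None" by (cases "deg (W - {v})") auto
  moreover have "V - {} - nbs {} - (V \<inter> nbs {v}) = W" by (auto simp: W_def nbs_def)
  ultimately show ?thesis by (simp add: dg_def)
qed

text \<open>If all neighbours of \<open>v\<close> are similar, then
  \<open>del_deg s < link_deg s\<close> for a neighbour \<open>s\<close>, and the swap gives
  \<open>link_deg v < del_deg v\<close>. If the neighbours of \<open>s\<close> are all similar too,
  \<open>v\<close> is among them and satisfies the reverse inequality. Otherwise \<open>s\<close>
  and two of its neighbours are pairwise dissimilar, and three swaps equate the two degrees of
  \<open>s\<close>.\<close>

lemma nbs_not_one_class:
  assumes v: "v \<in> V"
  obtains s t where "s \<in> V" "t \<in> V" "(v, s) \<in> E" "(v, t) \<in> E" "\<not> sim s t"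
proof -
  have one_class: "del_deg s < link_deg s"
    if "v \<in> V" "\<And>s t. s \<in> V \<Longrightarrow> t \<in> V \<Longrightarrow> (v, s) \<in> E \<Longrightarrow> (v, t) \<in> E \<Longrightarrow> sim s t"
      "s \<in> V" "(v, s) \<in> E" for v s
    by (rule sim_class_removal_None[OF _ _ _ nbs_removal_None[OF that(1)]])
       (use that in \<open>auto simp: nbs_def\<close>)
  have "\<exists>s t. s \<in> V \<and> t \<in> V \<and> (v, s) \<in> E \<and> (v, t) \<in> E \<and> \<not> sim s t"
  proof (rule ccontr)
    assume H: "\<not> ?thesis"
    obtain s where s: "s \<in> V" "(v, s) \<in> E" using not_isolated[OF v] by blast
    have xs: "del_deg s < link_deg s" using one_class[OF v _ s] H by blast
    have vs: "\<not> sim v s" using edge_not_sim v s by blast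
    have sv: "(s, v) \<in> E" using s sym by blast
    note vsD = not_simD[OF v s(1) vs]
    show False
    proof (cases "\<exists>p r. p \<in> V \<and> r \<in> V \<and> (s, p) \<in> E \<and> (s, r) \<in> E \<and> \<not> sim p r")
      case True
      then obtain p r where pr: "p \<in> V" "r \<in> V" "(s, p) \<in> E" "(s, r) \<in> E" "\<not> sim p r" by blast
      have "\<not> sim s p" "\<not> sim s r" using edge_not_sim s pr by blast+
      then show False
        using xs not_simD(3,4)[of s p] not_simD(3,4)[of s r] not_simD(3,4)[of p r] s pr by simp
    next
      case False
      then have "del_deg v < link_deg v" using one_class[OF s(1) _ v sv] by blast
      then show False using xs vsD by simp
    qed
  qed
  then show thesis using that by blast
qed

text \<open>\<open>v\<close> and two dissimilar neighbours are pairwise dissimilar, and three swaps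
  around this triangle equate the degrees of \<open>v\<close>.\<close>

lemma del_deg_eq_link_deg: "v \<in> V \<Longrightarrow> del_deg v = link_deg v"
proof -
  assume v: "v \<in> V"
  obtain s t where st: "s \<in> V" "t \<in> V" "(v, s) \<in> E" "(v, t) \<in> E" "\<not> sim s t"
    using nbs_not_one_class[OF v] .
  have "\<not> sim v s" "\<not> sim v t" using edge_not_sim v st by blast+
  then show "del_deg v = link_deg v"
    using not_simD(3,4)[of v s] not_simD(3,4)[of v t] not_simD(3,4)[of s t] v st by simp
qed

text \<open>Otherwise remove \<open>z\<close> from \<open>V - {u, v, w}\<close>: by
  \<open>triple\<close>, the outer terms have degrees \<open>del_deg w - 1\<close> and
  \<open>del_deg z - 1\<close>. These coincide, but two nonvanishing outer terms must differ by
  one.\<close>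

lemma edges_share_class:
  assumes V: "u \<in> V" "v \<in> V" "w \<in> V" "z \<in> V" and uv: "(u, v) \<in> E" and wz: "(w, z) \<in> E"
  shows "sim u w \<or> sim u z \<or> sim v w \<or> sim v z"
proof (rule ccontr)
  assume "\<not> ?thesis"
  then have ns: "\<not> sim u w" "\<not> sim u z" "\<not> sim v w" "\<not> sim v z" by auto
  have edges: "\<not> sim u v" "\<not> sim w z" using edge_not_sim V uv wz by blast+
  have ne: "u \<noteq> v" "w \<noteq> z" "u \<noteq> w" "u \<noteq> z" "v \<noteq> w" "v \<noteq> z"
    using ns edges by (auto simp: sim_def)
  have triple: "dg {} {u, v, p} = Some (del_deg p - 1)" if "p \<in> V" "\<not> sim u p" "\<not> sim v p" for p
  proof -
    have "u \<noteq> p" "v \<noteq> p" using that by (auto simp: sim_def)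
    then have "exact_degrees (dg {} {v, p}) (dg {} {u, v, p}) (dg {u} {v, p})"
      using dg_exact[of "{}" "{v, p}" u] that V ne by (simp add: nbs_def)
    moreover have "dg {u} {v, p} = dg {u} {p}" using uv by (intro dg_nbs) (simp add: nbs_def)
    ultimately show ?thesis using not_simD[of v p] not_simD[of u p] V that by simp
  qed
  have "exact_degrees (dg {} {u, v, w}) (dg {} {u, v, w, z}) (dg {z} {u, v, w})"
    using dg_exact[of "{}" "{u, v, w}" z] V ne by (simp add: nbs_def insert_commute)
  moreover have "dg {z} {u, v, w} = dg {z} {u, v}"
    using dg_nbs[of w "{z}" "{u, v}"] sym[OF wz] by (simp add: nbs_def insert_commute)
  moreover have "exact_degrees (dg {} {u, v}) (dg {} {u, v, z}) (dg {z} {u, v})"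
    using dg_exact[of "{}" "{u, v}" z] V ne by (simp add: nbs_def insert_commute)
  ultimately have "exact_degrees (Some (del_deg w - 1)) (dg {} {u, v, w, z}) (Some (del_deg z - 1))"
    using triple[of w] triple[of z] ns V not_simD(1)[of u v] edges by simp
  moreover have "del_deg w = del_deg z" using del_deg_eq_link_deg[OF V(4)] not_simD(3)[of w z] V edges by simp
  ultimately show False by simp
qed

lemma three_classes:
  obtains c :: "'a \<Rightarrow> nat" where "\<And>v. c v < 3" "\<And>u v. u \<in> V \<Longrightarrow> v \<in> V \<Longrightarrow> c u = c v \<Longrightarrow> sim u v"
    "\<And>u v. u \<in> V \<Longrightarrow> v \<in> V \<Longrightarrow> sim u v \<Longrightarrow> c u = c v"
proof -
  obtain r where r: "r \<in> V" using V_nonempty by blast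
  obtain s t where st: "s \<in> V" "t \<in> V" "(r, s) \<in> E" "(r, t) \<in> E" "\<not> sim s t"
    using nbs_not_one_class[OF r] .
  have rs: "\<not> sim r s" "\<not> sim r t" using edge_not_sim r st by blast+
  \<comment> \<open>A neighbour of \<open>s\<close> outside the class of \<open>r\<close> turns out
    to be similar to \<open>t\<close>, so this edge stands in for one between \<open>s\<close> and
    \<open>t\<close>.\<close>
  obtain p where p: "p \<in> V" "(s, p) \<in> E" "\<not> sim p r"
  proof -
    obtain p p' where "p \<in> V" "p' \<in> V" "(s, p) \<in> E" "(s, p') \<in> E" "\<not> sim p p'"
      using nbs_not_one_class[OF st(1)] .
    then show thesis using that sim_trans[of p r p'] sim_sym r by blast
  qed
  have "sim p t"
    using edges_share_class[OF st(1) p(1) r st(2) p(2) st(4)] rs st p sim_sym by blast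
  have cover: "sim u r \<or> sim u s \<or> sim u t" if u: "u \<in> V" for u
  proof (rule ccontr)
    assume nu: "\<not> ?thesis"
    obtain w where w: "w \<in> V" "(u, w) \<in> E" using not_isolated[OF u] by blast
    \<comment> \<open>Comparison with edges joining the three classes pairwise puts \<open>w\<close>
      into two of them.\<close>
    have "sim w r \<or> sim w s" "sim w r \<or> sim w t" "sim w s \<or> sim w p"
      using edges_share_class[OF u w(1) r st(1) w(2) st(3)] edges_share_class[OF u w(1) r st(2) w(2) st(4)]
        edges_share_class[OF u w(1) st(1) p(1) w(2) p(2)] nu sim_trans[OF u p(1) st(2) _ \<open>sim p t\<close>] by blast+
    then have "sim w r \<or> sim w s" "sim w r \<or> sim w t" "sim w s \<or> sim w t"
      using sim_trans[OF w(1) p(1) st(2) _ \<open>sim p t\<close>] by blast+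
    then show False
      using sim_trans[of r w s] sim_trans[of r w t] sim_trans[of s w t] sim_sym w(1) r st rs by blast
  qed
  \<comment> \<open>By \<open>cover\<close>, the remaining value 2 means similarity to
    \<open>t\<close>.\<close>
  define c :: "'a \<Rightarrow> nat" where "c v = (if sim v r then 0 else if sim v s then 1 else 2)" for v
  show thesis
  proof (rule that[of c])
    show "c v < 3" for v by (simp add: c_def)
    have "\<exists>z\<in>V. sim u z \<and> sim v z" if "u \<in> V" "v \<in> V" "c u = c v" for u v
      using cover[OF that(1)] cover[OF that(2)] that(3) r st by (auto simp: c_def split: if_splits)
    then show "sim u v" if "u \<in> V" "v \<in> V" "c u = c v" for u v
      using that sim_trans[of u _ v] sim_sym by blast
    show "c u = c v" if "u \<in> V" "v \<in> V" "sim u v" for u v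
    proof -
      have "sim u z \<longleftrightarrow> sim v z" if "z \<in> V" for z
        using sim_trans[of u v z] sim_trans[of v u z] sim_sym \<open>sim u v\<close> \<open>u \<in> V\<close> \<open>v \<in> V\<close> that by blast
      then show ?thesis using r st by (simp add: c_def)
    qed
  qed
qed

theorem induced_cycle_exists:
  obtains vs where "3 \<le> length vs" "3 dvd length vs" "distinct vs" "set vs \<subseteq> V"
    "\<And>i j. i < length vs \<Longrightarrow> j < length vs \<Longrightarrow>
       (vs ! i, vs ! j) \<in> E \<longleftrightarrow> j = Suc i mod length vs \<or> i = Suc j mod length vs"
proof -
  obtain c :: "'a \<Rightarrow> nat" where c: "\<And>v. c v < 3" "\<And>u v. u \<in> V \<Longrightarrow> v \<in> V \<Longrightarrow> c u = c v \<Longrightarrow> sim u v"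
    "\<And>u v. u \<in> V \<Longrightarrow> v \<in> V \<Longrightarrow> sim u v \<Longrightarrow> c u = c v"
    using three_classes by blast
  have out: "\<exists>w\<in>V. (v, w) \<in> E \<and> c w = Suc (c v) mod 3" if v: "v \<in> V" for v
  proof -
    obtain s t where st: "s \<in> V" "t \<in> V" "(v, s) \<in> E" "(v, t) \<in> E" "\<not> sim s t"
      using nbs_not_one_class[OF v] .
    have "c v \<noteq> c s" "c v \<noteq> c t" "c s \<noteq> c t" using c(2) edge_not_sim v st by blast+
    then have "c s = Suc (c v) mod 3 \<or> c t = Suc (c v) mod 3"
      using mod_3_successor_exhaust[OF c(1) c(1) c(1)] by blast
    then show ?thesis using st by blast
  qed
  have "c u \<noteq> c v" if "u \<in> V" "v \<in> V" "(u, v) \<in> E" for u v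
    using edge_not_sim[OF that] c(2) that by blast
  from three_coloured_induced_cycle[OF finite_V V_nonempty sym c(1) this out] that
  show thesis by blast
qed

end


section \<open>Finite-dimensional spaces of functions\<close>

text \<open>\<open>cycle_space\<close> with an arbitrary carrier, so that chains, cycles, boundaries
  and their intersections are compared in one setting.\<close>

definition fun_space :: "('b \<Rightarrow> rat) set \<Rightarrow> (rat, 'b \<Rightarrow> rat) module" where
  "fun_space S =
     \<lparr>carrier = S, mult = undefined, one = undefined,
      zero = (\<lambda>_. 0), add = (\<lambda>c d x. c x + d x), smult = (\<lambda>r c x. r * c x)\<rparr>"

definition fun_subspace :: "('b \<Rightarrow> rat) set \<Rightarrow> bool" where
  "fun_subspace S \<longleftrightarrow> (\<lambda>_. 0) \<in> S \<and>
     (\<forall>c\<in>S. \<forall>d\<in>S. (\<lambda>x. c x + d x) \<in> S) \<and> (\<forall>r. \<forall>c\<in>S. (\<lambda>x. r * c x) \<in> S)"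

abbreviation fun_dim :: "('b \<Rightarrow> rat) set \<Rightarrow> nat" where
  "fun_dim S \<equiv> vectorspace.dim class_ring (fun_space S)"

lemma fun_space_simps [simp]:
  "carrier (fun_space S) = S" "zero (fun_space S) = (\<lambda>_. 0)"
  "add (fun_space S) = (\<lambda>c d x. c x + d x)" "smult (fun_space S) = (\<lambda>r c x. r * c x)"
  "fun_space S\<lparr>carrier := T\<rparr> = fun_space T"
  by (auto simp: fun_space_def)

lemma fun_subspaceD:
  assumes "fun_subspace S"
  shows "(\<lambda>_. 0) \<in> S" "c \<in> S \<Longrightarrow> d \<in> S \<Longrightarrow> (\<lambda>x. c x + d x) \<in> S" "c \<in> S \<Longrightarrow> (\<lambda>x. r * c x) \<in> S"
  using assms by (auto simp: fun_subspace_def)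

lemma vectorspace_fun_space:
  assumes "fun_subspace S"
  shows "vectorspace class_ring (fun_space S)"
proof -
  note lin = fun_subspaceD[OF assms]
  have "abelian_group (fun_space S)"
  proof (rule abelian_groupI)
    fix c assume "c \<in> carrier (fun_space S)"
    then show "\<exists>d\<in>carrier (fun_space S). d \<oplus>\<^bsub>fun_space S\<^esub> c = \<zero>\<^bsub>fun_space S\<^esub>"
      using lin(3)[of c "-1"] by (intro bexI[of _ "\<lambda>x. -1 * c x"]) auto
  qed (auto simp: lin algebra_simps)
  moreover have "cring (class_ring :: rat ring)" "field (class_ring :: rat ring)"
    using class_field by (auto simp: field_def domain_def)
  ultimately show ?thesis
    unfolding vectorspace_def
    by (auto intro!: moduleI simp: lin algebra_simps class_ring_simps)
qed

lemma subspace_fun_space: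
  assumes "fun_subspace S" "fun_subspace T" "S \<subseteq> T"
  shows "subspace class_ring S (fun_space T)"
proof -
  interpret vectorspace class_ring "fun_space T" by (rule vectorspace_fun_space[OF assms(2)])
  show ?thesis
    using fun_subspaceD[OF assms(1)] assms(3)
    by (intro subspace.intro submodule.intro vectorspace_axioms module_axioms) auto
qed

text \<open>The indicator functions of the points of \<open>X\<close> span the space, by induction
  on a set containing the support.\<close>

lemma fun_space_supported:
  assumes "finite X"
  shows "vectorspace.fin_dim class_ring (fun_space {c :: 'b \<Rightarrow> rat. \<forall>x. c x \<noteq> 0 \<longrightarrow> x \<in> X})"
    and "fun_dim {c :: 'b \<Rightarrow> rat. \<forall>x. c x \<noteq> 0 \<longrightarrow> x \<in> X} \<le> card X"
proof -
  define F where "F = {c :: 'b \<Rightarrow> rat. \<forall>x. c x \<noteq> 0 \<longrightarrow> x \<in> X}"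
  have F: "fun_subspace F" by (auto simp: F_def fun_subspace_def) (metis add.right_neutral)
  interpret vectorspace class_ring "fun_space F" by (rule vectorspace_fun_space[OF F])
  define \<delta> where "\<delta> y = (\<lambda>x. if x = y then 1 else 0 :: rat)" for y :: 'b
  have AF: "\<delta> ` X \<subseteq> carrier (fun_space F)" by (auto simp: \<delta>_def F_def split: if_splits)
  interpret S: submodule class_ring "span (\<delta> ` X)" "fun_space F"
    using span_is_subspace[OF AF] by (simp add: subspace_def)
  have gen: "c \<in> span (\<delta> ` X)" if "finite Y" "Y \<subseteq> X" "\<forall>x. c x \<noteq> 0 \<longrightarrow> x \<in> Y" for Y c
    using that
  proof (induction Y arbitrary: c)
    case empty
    then have "c = \<zero>\<^bsub>fun_space F\<^esub>" by auto
    then show ?case using S.zero_closed by simp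
  next
    case (insert y Y)
    have "\<delta> y \<in> span (\<delta> ` X)" using insert.prems by (intro span_mem[OF AF]) auto
    then have "c y \<odot>\<^bsub>fun_space F\<^esub> \<delta> y \<in> span (\<delta> ` X)" by (rule S.smult_closed[rotated]) simp
    moreover have "c(y := 0) \<in> span (\<delta> ` X)" using insert.prems by (intro insert.IH) auto
    ultimately have "c(y := 0) \<oplus>\<^bsub>fun_space F\<^esub> (c y \<odot>\<^bsub>fun_space F\<^esub> \<delta> y) \<in> span (\<delta> ` X)"
      by (intro S.m_closed)
    moreover have "c(y := 0) \<oplus>\<^bsub>fun_space F\<^esub> (c y \<odot>\<^bsub>fun_space F\<^esub> \<delta> y) = c"
      by (auto simp: \<delta>_def)
    ultimately show ?case by simp
  qed
  have gen_set: "span (\<delta> ` X) = carrier (fun_space F)"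
    using gen[OF assms order_refl] S.subset by (auto simp: F_def)
  then show "vectorspace.fin_dim class_ring (fun_space {c :: 'b \<Rightarrow> rat. \<forall>x. c x \<noteq> 0 \<longrightarrow> x \<in> X})"
    unfolding fin_dim_def F_def[symmetric] using assms AF by blast
  have "dim \<le> card (\<delta> ` X)" using gen_ge_dim[OF _ AF gen_set] assms by simp
  also have "\<dots> \<le> card X" using assms by (rule card_image_le)
  finally show "fun_dim {c :: 'b \<Rightarrow> rat. \<forall>x. c x \<noteq> 0 \<longrightarrow> x \<in> X} \<le> card X"
    unfolding F_def .
qed

text \<open>Independent subsets of \<open>S\<close> stay independent among all functions supported
  on \<open>X\<close>, which bounds their size; a maximal one is a finite basis.\<close>

lemma fin_dim_fun_space:
  fixes S :: "('b \<Rightarrow> rat) set"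
  assumes S: "fun_subspace S" and X: "finite X" and supp: "\<And>c x. c \<in> S \<Longrightarrow> c x \<noteq> 0 \<Longrightarrow> x \<in> X"
  shows "vectorspace.fin_dim class_ring (fun_space S)"
proof -
  define F where "F = {c :: 'b \<Rightarrow> rat. \<forall>x. c x \<noteq> 0 \<longrightarrow> x \<in> X}"
  have F: "fun_subspace F" by (auto simp: F_def fun_subspace_def) (metis add.right_neutral)
  interpret F: vectorspace class_ring "fun_space F" by (rule vectorspace_fun_space[OF F])
  interpret S: vectorspace class_ring "fun_space S" by (rule vectorspace_fun_space[OF S])
  have finF: "F.fin_dim" unfolding F_def by (rule fun_space_supported(1)[OF X])
  have SF: "S \<subseteq> F" using supp by (auto simp: F_def)
  have sub: "submodule class_ring S (fun_space F)"
    using subspace_fun_space[OF S F SF] by (simp add: subspace_def)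
  have li: "finite A \<and> card A \<le> F.dim" if "A \<subseteq> carrier (fun_space S) \<and> S.lin_indpt A" for A
  proof -
    have "A \<subseteq> S" "S.lin_indpt A" using that by auto
    then have "F.lin_indpt A" using F.span_li_not_depend(2)[OF _ sub, of A] by simp
    then show ?thesis using F.li_le_dim[OF finF _, of A] \<open>A \<subseteq> S\<close> SF by auto
  qed
  have "S.lin_indpt {}" by (auto simp: S.lin_dep_def)
  then obtain A where A: "finite A" "maximal A (\<lambda>A. A \<subseteq> carrier (fun_space S) \<and> S.lin_indpt A)"
    using maximal_exists[of "\<lambda>A. A \<subseteq> carrier (fun_space S) \<and> S.lin_indpt A", OF li] by blast
  then have "S.basis A" using S.max_li_is_basis by blast
  then show ?thesis unfolding S.fin_dim_def S.basis_def using A(1) by blast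
qed

lemma fun_dim_rank_nullity:
  fixes T :: "('b \<Rightarrow> rat) \<Rightarrow> ('c \<Rightarrow> rat)"
  assumes S: "fun_subspace S" and fin: "vectorspace.fin_dim class_ring (fun_space S)"
    and add: "\<And>c d. c \<in> S \<Longrightarrow> d \<in> S \<Longrightarrow> T (\<lambda>x. c x + d x) = (\<lambda>x. T c x + T d x)"
    and smult: "\<And>r c. c \<in> S \<Longrightarrow> T (\<lambda>x. r * c x) = (\<lambda>x. r * T c x)"
  shows "fun_dim S = fun_dim (T ` S) + fun_dim {c \<in> S. T c = (\<lambda>_. 0)}"
proof -
  note lin = fun_subspaceD[OF S]
  have "T (\<lambda>_. 0) = (\<lambda>_. 0)" using smult[OF lin(1), of 0] by simp
  then have zero: "(\<lambda>_. 0) \<in> T ` S" by (metis imageI lin(1))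
  have "fun_subspace (T ` S)"
    unfolding fun_subspace_def
  proof (intro conjI ballI allI zero)
    fix c d assume "c \<in> T ` S" "d \<in> T ` S"
    then obtain c' d' where "c' \<in> S" "d' \<in> S" "c = T c'" "d = T d'" by blast
    then show "(\<lambda>x. c x + d x) \<in> T ` S" using add[of c' d'] lin(2)[of c' d'] by (metis imageI)
  next
    fix r c assume "c \<in> T ` S"
    then obtain c' where "c' \<in> S" "c = T c'" by blast
    then show "(\<lambda>x. r * c x) \<in> T ` S" using smult[of c' r] lin(3)[of c' r] by (metis imageI)
  qed
  then interpret W: vectorspace class_ring "fun_space (T ` S)" by (rule vectorspace_fun_space)
  interpret V: vectorspace class_ring "fun_space S" by (rule vectorspace_fun_space[OF S])
  interpret linear_map class_ring "fun_space S" "fun_space (T ` S)" T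
    by unfold_locales (auto simp: module_hom_def add smult)
  show ?thesis using rank_nullity[OF fin] by (simp add: im_def ker_def)
qed

lemma fun_dim_mono:
  assumes S: "fun_subspace S" "fun_subspace T" "S \<subseteq> T"
    and X: "finite X" "\<And>c x. c \<in> T \<Longrightarrow> c x \<noteq> 0 \<Longrightarrow> x \<in> X"
  shows "fun_dim S \<le> fun_dim T"
proof -
  interpret vectorspace class_ring "fun_space T" by (rule vectorspace_fun_space[OF S(2)])
  have T: "fin_dim" by (rule fin_dim_fun_space[OF S(2) X])
  have "vectorspace.fin_dim class_ring (fun_space S)"
    by (rule fin_dim_fun_space[OF S(1) X(1)]) (use X S(3) in blast)
  then show ?thesis
    using subspace_dim[OF subspace_fun_space[OF S] T] by simp
qed


lemma fun_dim_le_card: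
  fixes S :: "('b \<Rightarrow> rat) set"
  assumes S: "fun_subspace S" and X: "finite X" and supp: "\<And>c x. c \<in> S \<Longrightarrow> c x \<noteq> 0 \<Longrightarrow> x \<in> X"
  shows "fun_dim S \<le> card X"
proof -
  define F where "F = {c :: 'b \<Rightarrow> rat. \<forall>x. c x \<noteq> 0 \<longrightarrow> x \<in> X}"
  have F: "fun_subspace F" by (auto simp: F_def fun_subspace_def) (metis add.right_neutral)
  have "fun_dim S \<le> fun_dim F"
    by (rule fun_dim_mono[OF S F _ X]) (use supp in \<open>auto simp: F_def\<close>)
  also have "\<dots> \<le> card X" unfolding F_def by (rule fun_space_supported(2)[OF X])
  finally show ?thesis .
qed

text \<open>Rank-nullity for the projection to cosets, which is onto and has kernel
  \<open>W\<close>.\<close>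

lemma dim_quot_module:
  assumes V: "vectorspace F V" and W: "subspace F W V" and fin: "vectorspace.fin_dim F V"
  shows "vectorspace.dim F V = vectorspace.dim F (quot_module V W) + vectorspace.dim F (V\<lparr>carrier := W\<rparr>)"
proof -
  interpret V: vectorspace F V by fact
  interpret W: submodule F W V using W by (simp add: subspace_def)
  interpret Q: vectorspace F "quot_module V W" by (rule vectorspace_quot_module[OF V W])
  have neg: "\<ominus>\<^bsub>V\<^esub> w \<in> W" if "w \<in> W" for w
  proof -
    have "(\<ominus>\<^bsub>F\<^esub> \<one>\<^bsub>F\<^esub>) \<odot>\<^bsub>V\<^esub> w \<in> W"
      by (rule W.smult_closed) (use that in simp_all)
    moreover have "(\<ominus>\<^bsub>F\<^esub> \<one>\<^bsub>F\<^esub>) \<odot>\<^bsub>V\<^esub> w = \<ominus>\<^bsub>V\<^esub> w"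
      by (rule V.smult_minus_1) (use that W.subset in blast)
    ultimately show ?thesis by metis
  qed
  have "additive_subgroup W V"
    unfolding additive_subgroup_def
    by (rule subgroup.intro) (use W.subset neg in \<open>auto simp: a_inv_def[symmetric]\<close>)
  then interpret A: abelian_subgroup W V
    by (intro abelian_subgroupI3) (auto simp: V.abelian_group_axioms)
  have coset: "W +>\<^bsub>V\<^esub> x = {w \<oplus>\<^bsub>V\<^esub> x | w. w \<in> W}" for x
    by (auto simp: a_r_coset_def r_coset_def)
  have car: "carrier (quot_module V W) = (\<lambda>x. W +>\<^bsub>V\<^esub> x) ` carrier V"
    by (auto simp: quot_module_def A_RCOSETS_def RCOSETS_def a_r_coset_def)
  have sm: "r \<odot>\<^bsub>quot_module V W\<^esub> (W +>\<^bsub>V\<^esub> x) = W +>\<^bsub>V\<^esub> (r \<odot>\<^bsub>V\<^esub> x)"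
    if r: "r \<in> carrier F" and x: "x \<in> carrier V" for r x
  proof (intro equalityI subsetI)
    fix y assume "y \<in> r \<odot>\<^bsub>quot_module V W\<^esub> (W +>\<^bsub>V\<^esub> x)"
    then obtain w w' where w: "w \<in> W" "w' \<in> W" "y = w \<oplus>\<^bsub>V\<^esub> r \<odot>\<^bsub>V\<^esub> (w' \<oplus>\<^bsub>V\<^esub> x)"
      by (auto simp: quot_module_def set_add_def set_mult_def coset)
    have "y = (w \<oplus>\<^bsub>V\<^esub> r \<odot>\<^bsub>V\<^esub> w') \<oplus>\<^bsub>V\<^esub> r \<odot>\<^bsub>V\<^esub> x"
      using w r x W.subset by (auto simp: V.smult_r_distr V.M.a_assoc subset_iff)
    then show "y \<in> W +>\<^bsub>V\<^esub> (r \<odot>\<^bsub>V\<^esub> x)"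
      unfolding coset using w r by blast
  next
    fix y assume "y \<in> W +>\<^bsub>V\<^esub> (r \<odot>\<^bsub>V\<^esub> x)"
    then obtain w where w: "w \<in> W" "y = w \<oplus>\<^bsub>V\<^esub> r \<odot>\<^bsub>V\<^esub> x" by (auto simp: coset)
    have "\<zero>\<^bsub>V\<^esub> \<oplus>\<^bsub>V\<^esub> x \<in> W +>\<^bsub>V\<^esub> x" unfolding coset using W.zero_closed by blast
    then have "x \<in> W +>\<^bsub>V\<^esub> x" using x by simp
    then show "y \<in> r \<odot>\<^bsub>quot_module V W\<^esub> (W +>\<^bsub>V\<^esub> x)"
      using w by (auto simp: quot_module_def set_add_def set_mult_def)
  qed
  have ad: "(W +>\<^bsub>V\<^esub> x) \<oplus>\<^bsub>quot_module V W\<^esub> (W +>\<^bsub>V\<^esub> y) = W +>\<^bsub>V\<^esub> (x \<oplus>\<^bsub>V\<^esub> y)"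
    if "x \<in> carrier V" "y \<in> carrier V" for x y
    using that A.a_rcos_sum by (simp add: quot_module_def)
  have "W +>\<^bsub>V\<^esub> x \<in> carrier (quot_module V W)" if "x \<in> carrier V" for x
    unfolding car using that by (rule imageI)
  then have "(\<lambda>x. W +>\<^bsub>V\<^esub> x) \<in> module_hom F V (quot_module V W)"
    unfolding module_hom_def by (simp add: sm ad)
  then interpret linear_map F V "quot_module V W" "\<lambda>x. W +>\<^bsub>V\<^esub> x"
    by unfold_locales
  have "W +>\<^bsub>V\<^esub> x = W \<longleftrightarrow> x \<in> W" if "x \<in> carrier V" for x
    using that A.a_rcos_const A.a_rcos_self by blast
  moreover have "\<zero>\<^bsub>quot_module V W\<^esub> = W" by (simp add: quot_module_def)
  ultimately have ker: "ker = W" unfolding ker_def using W.subset by blast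
  have self: "M\<lparr>carrier := carrier M\<rparr> = M" for M :: "('x, 'y) module" by simp
  have "im = carrier (quot_module V W)" by (rule trans[OF im_def car[symmetric]])
  then have im: "quot_module V W\<lparr>carrier := im\<rparr> = quot_module V W"
    using self[of "quot_module V W"] by metis
  show ?thesis using rank_nullity[OF fin] unfolding ker im by (rule sym)
qed


section \<open>The exact sequence of a vertex\<close>

definition deletion :: "'a set set \<Rightarrow> 'a \<Rightarrow> 'a set set" where
  "deletion K v = {S \<in> K. v \<notin> S}"

definition link :: "'a set set \<Rightarrow> 'a \<Rightarrow> 'a set set" where
  "link K v = {S. v \<notin> S \<and> insert v S \<in> K}"

text \<open>The join of \<open>v\<close> with the chain \<open>d\<close>: the first \<open>v\<close>
  in a list is moved to the front, with the sign of that move, and dropped; lists without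
  \<open>v\<close> get 0.\<close>

fun cone :: "'a \<Rightarrow> ('a list \<Rightarrow> rat) \<Rightarrow> 'a list \<Rightarrow> rat" where
  "cone v d [] = 0"
| "cone v d (x # xs) = (if x = v then d xs else - cone v (\<lambda>ys. d (x # ys)) xs)"

lemma cone_linear:
  "cone v (\<lambda>_. 0) xs = 0"
  "cone v (\<lambda>ys. - d ys) xs = - cone v d xs"
  "cone v (\<lambda>ys. \<Sum>w\<in>A. e w ys) xs = (\<Sum>w\<in>A. cone v (e w) xs)"
proof -
  show "cone v (\<lambda>_. 0) xs = 0" by (induction xs) auto
  show "cone v (\<lambda>ys. - d ys) xs = - cone v d xs" by (induction xs arbitrary: d) auto
  show "cone v (\<lambda>ys. \<Sum>w\<in>A. e w ys) xs = (\<Sum>w\<in>A. cone v (e w) xs)"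
    by (induction xs arbitrary: e) (auto simp: sum_negf)
qed

lemma cone_swap:
  assumes "\<And>xs u w ys. d (xs @ w # u # ys) = - d (xs @ u # w # ys)"
    and "\<And>ys. v \<in> set ys \<Longrightarrow> d ys = 0"
  shows "cone v d (xs @ w # u # ys) = - cone v d (xs @ u # w # ys)"
  using assms
proof (induction xs arbitrary: d)
  case Nil
  have "d (w # u # zs) = - d (u # w # zs)" for zs using Nil.prems(1)[of "[]" w u zs] by simp
  then have "cone v (\<lambda>zs. d (w # u # zs)) ys = - cone v (\<lambda>zs. d (u # w # zs)) ys"
    using cone_linear(2)[of v "\<lambda>zs. d (u # w # zs)"] by simp
  \<comment> \<open>The vanishing of \<open>d\<close> on lists containing \<open>v\<close> settles
    the case where both exchanged entries are \<open>v\<close>.\<close>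
  then show ?case using Nil.prems(2) by auto
next
  case (Cons x xs)
  have "cone v (\<lambda>zs. d (x # zs)) (xs @ w # u # ys) = - cone v (\<lambda>zs. d (x # zs)) (xs @ u # w # ys)"
  proof (rule Cons.IH)
    show "d (x # (as @ b # a # bs)) = - d (x # (as @ a # b # bs))" for as a b bs
      using Cons.prems(1)[of "x # as" b a bs] by simp
    show "v \<in> set zs \<Longrightarrow> d (x # zs) = 0" for zs using Cons.prems(2)[of "x # zs"] by simp
  qed
  then show ?case using Cons.prems(1)[of xs w u ys] by simp
qed

lemma cone_nonzeroE:
  assumes "cone v d xs \<noteq> 0"
  obtains ys zs where "xs = ys @ v # zs" "v \<notin> set ys" "d (ys @ zs) \<noteq> 0"
proof -
  have "\<exists>ys zs. xs = ys @ v # zs \<and> v \<notin> set ys \<and> d (ys @ zs) \<noteq> 0" using assms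
  proof (induction xs arbitrary: d)
    case (Cons x xs)
    show ?case
    proof (cases "x = v")
      case True
      with Cons.prems show ?thesis by (intro exI[of _ "[]"] exI[of _ xs]) simp
    next
      case False
      then obtain ys zs where "xs = ys @ v # zs" "v \<notin> set ys" "d (x # ys @ zs) \<noteq> 0"
        using Cons.IH[of "\<lambda>ys. d (x # ys)"] Cons.prems by auto
      with False show ?thesis by (intro exI[of _ "x # ys"] exI[of _ zs]) simp
    qed
  qed simp
  then show thesis using that by blast
qed

lemma chain_swap: "c \<in> simplicial_chains K i \<Longrightarrow> c (xs @ v # u # ys) = - c (xs @ u # v # ys)"
  unfolding simplicial_chains_def by blast

lemma chain_support:
  "c \<in> simplicial_chains K i \<Longrightarrow> c xs \<noteq> 0 \<Longrightarrow> distinct xs \<and> set xs \<in> K \<and> int (length xs) = i + 1"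
  unfolding simplicial_chains_def by blast

lemma simplicial_chainsI:
  assumes "\<And>xs. c xs \<noteq> 0 \<Longrightarrow> distinct xs \<and> set xs \<in> K \<and> int (length xs) = i + 1"
    and "\<And>xs u v ys. c (xs @ v # u # ys) = - c (xs @ u # v # ys)"
  shows "c \<in> simplicial_chains K i"
  unfolding simplicial_chains_def mem_Collect_eq using assms by blast

lemma simplicial_chains_mono: "K \<subseteq> L \<Longrightarrow> simplicial_chains K i \<subseteq> simplicial_chains L i"
  unfolding simplicial_chains_def by blast

lemma chain_move_front:
  assumes "c \<in> simplicial_chains K i"
  shows "c (ys @ v # zs) = (-1) ^ length ys * c (v # ys @ zs)"
proof (induction ys arbitrary: zs rule: rev_induct)
  case (snoc u ys)
  show ?case using snoc[of "u # zs"] chain_swap[OF assms, of ys u v zs] by simp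
qed simp

definition finite_complex :: "'a set set \<Rightarrow> bool" where
  "finite_complex K \<longleftrightarrow> finite (\<Union>K) \<and> (\<forall>S\<in>K. \<forall>T\<subseteq>S. T \<in> K)"

lemma boundary_on_superset:
  assumes "finite U" "\<Union>K \<subseteq> U" "c \<in> simplicial_chains K i"
  shows "simplicial_boundary K c xs = (\<Sum>w\<in>U. c (w # xs))"
  unfolding simplicial_boundary_def
  using assms(1,2) chain_support[OF assms(3)] by (intro sum.mono_neutral_left) fastforce+

text \<open>Additional vertices contribute only zero coefficients, so boundaries in the deletion and
  the link can be computed in the whole complex.\<close>

lemma boundary_mono:
  assumes "K \<subseteq> L" "finite_complex L" "c \<in> simplicial_chains K i"
  shows "simplicial_boundary K c = simplicial_boundary L c"
proof
  show "simplicial_boundary K c xs = simplicial_boundary L c xs" for xs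
    unfolding simplicial_boundary_def[of L]
    by (rule boundary_on_superset[OF _ _ assms(3)]) (use assms in \<open>auto simp: finite_complex_def\<close>)
qed

lemma boundary_uminus: "simplicial_boundary K (\<lambda>xs. - c xs) = (\<lambda>xs. - simplicial_boundary K c xs)"
  by (simp add: simplicial_boundary_def sum_negf)

lemma boundary_diff:
  "simplicial_boundary K (\<lambda>xs. c xs - d xs) = (\<lambda>xs. simplicial_boundary K c xs - simplicial_boundary K d xs)"
  by (simp add: simplicial_boundary_def sum_subtractf)

lemma chains_uminus: "c \<in> simplicial_chains K i \<Longrightarrow> (\<lambda>xs. - c xs) \<in> simplicial_chains K i"
  using chains_linear(3)[of c K i "-1"] by simp

lemma chains_diff:
  "c \<in> simplicial_chains K i \<Longrightarrow> d \<in> simplicial_chains K i \<Longrightarrow> (\<lambda>xs. c xs - d xs) \<in> simplicial_chains K i"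
  using chains_linear(2)[of c K i "\<lambda>xs. - d xs"] chains_uminus[of d K i] by simp

lemma fun_subspace_chains: "fun_subspace (simplicial_chains K i)"
  by (simp add: fun_subspace_def chains_linear)

lemma fun_subspace_cycles: "fun_subspace (simplicial_cycles K i)"
  by (auto simp: fun_subspace_def simplicial_cycles_def chains_linear boundary_linear)

lemma fun_subspace_boundaries: "fun_subspace (simplicial_boundaries K i)"
  unfolding fun_subspace_def simplicial_boundaries_def
proof (intro conjI ballI allI)
  show "(\<lambda>_. 0) \<in> simplicial_boundary K ` simplicial_chains K (i + 1)"
    by (rule image_eqI[OF _ chains_linear(1)]) (simp add: boundary_linear)
qed (auto simp: boundary_linear[symmetric] intro!: imageI chains_linear)

lemma fun_subspace_Int: "fun_subspace S \<Longrightarrow> fun_subspace T \<Longrightarrow> fun_subspace (S \<inter> T)"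
  by (auto simp: fun_subspace_def)

lemma boundaries_subset_cycles:
  assumes "finite_complex K"
  shows "simplicial_boundaries K i \<subseteq> simplicial_cycles K i"
proof
  fix b assume "b \<in> simplicial_boundaries K i"
  then obtain c where c: "c \<in> simplicial_chains K (i + 1)" "b = simplicial_boundary K c"
    by (auto simp: simplicial_boundaries_def)
  have "b \<in> simplicial_chains K (i + 1 - 1)"
    unfolding c(2) by (rule simplicial_boundary_mem_chains[OF _ c(1)])
      (use assms in \<open>auto simp: finite_complex_def\<close>)
  then show "b \<in> simplicial_cycles K i"
    using boundary_boundary[OF c(1)] c(2) by (simp add: simplicial_cycles_def)
qed

lemma cycles_subset_chains: "simplicial_cycles K i \<subseteq> simplicial_chains K i"
  by (auto simp: simplicial_cycles_def)

lemma chains_finite_support: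
  assumes "c \<in> simplicial_chains K i" "c xs \<noteq> 0"
  shows "xs \<in> {xs. set xs \<subseteq> \<Union>K \<and> distinct xs}"
  using chain_support[OF assms] by auto

lemma finite_chain_support: "finite_complex K \<Longrightarrow> finite {xs. set xs \<subseteq> \<Union>K \<and> distinct xs}"
  by (rule finite_subset_distinct) (simp add: finite_complex_def)

lemma fin_dim_chain_subspace:
  assumes "finite_complex K" "fun_subspace S" "S \<subseteq> simplicial_chains K i"
  shows "vectorspace.fin_dim class_ring (fun_space S)"
  by (rule fin_dim_fun_space[OF assms(2) finite_chain_support[OF assms(1)]])
     (use chains_finite_support assms(3) in blast)

lemma chain_subspace_dim_mono:
  assumes "finite_complex K" "fun_subspace S" "fun_subspace T" "S \<subseteq> T" "T \<subseteq> simplicial_chains K i"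
  shows "fun_dim S \<le> fun_dim T"
  by (rule fun_dim_mono[OF assms(2-4) finite_chain_support[OF assms(1)]])
     (use chains_finite_support assms(5) in blast)

lemma betti_dim:
  assumes "finite_complex K"
  shows "reduced_betti K i + fun_dim (simplicial_boundaries K i) = fun_dim (simplicial_cycles K i)"
proof -
  have cs: "cycle_space K i = fun_space (simplicial_cycles K i)"
    by (simp add: cycle_space_def fun_space_def)
  have "subspace class_ring (simplicial_boundaries K i) (fun_space (simplicial_cycles K i))"
    by (intro subspace_fun_space fun_subspace_boundaries fun_subspace_cycles boundaries_subset_cycles assms)
  from dim_quot_module[OF vectorspace_fun_space[OF fun_subspace_cycles] this
      fin_dim_chain_subspace[OF assms fun_subspace_cycles cycles_subset_chains]]
  show ?thesis by (simp add: reduced_betti_def reduced_homology_def cs)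
qed

lemma chains_dim:
  assumes "finite_complex K"
  shows "fun_dim (simplicial_chains K (i + 1)) =
    fun_dim (simplicial_boundaries K i) + fun_dim (simplicial_cycles K (i + 1))"
  unfolding simplicial_boundaries_def simplicial_cycles_def
  by (rule fun_dim_rank_nullity)
     (auto simp: boundary_linear fun_subspace_chains intro: fin_dim_chain_subspace[OF assms])

text \<open>
  Betti numbers of a complex, of the deletion and of the link of a vertex, where \<open>\<rho> i\<close> is the
  rank of the map from the homology of the link to that of the deletion in the long exact sequence.
\<close>

definition betti_exact :: "(int \<Rightarrow> nat) \<Rightarrow> (int \<Rightarrow> nat) \<Rightarrow> (int \<Rightarrow> nat) \<Rightarrow> (int \<Rightarrow> nat) \<Rightarrow> bool" where
  "betti_exact \<gamma> \<alpha> \<beta> \<rho> \<longleftrightarrow> (\<forall>i. \<rho> i \<le> \<alpha> i \<and> \<rho> i \<le> \<beta> i \<and> \<gamma> (i + 1) + \<rho> (i + 1) + \<rho> i = \<alpha> (i + 1) + \<beta> i)"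

section \<open>Chains, cycles and boundaries of the deletion and the link\<close>

locale complex_vertex =
  fixes K :: "'a set set" and v :: 'a
  assumes complex: "finite_complex K" and v: "{v} \<in> K"
begin

abbreviation "D \<equiv> deletion K v"
abbreviation "L \<equiv> link K v"

lemma complex_D: "finite_complex D" and complex_L: "finite_complex L"
  and L_D: "L \<subseteq> D" and D_K: "D \<subseteq> K" and L_K: "L \<subseteq> K"
proof -
  have down: "T \<in> K" if "S \<in> K" "T \<subseteq> S" for S T using complex that by (auto simp: finite_complex_def)
  show "D \<subseteq> K" by (auto simp: deletion_def)
  show "L \<subseteq> D" using down by (auto simp: deletion_def link_def)
  then show "L \<subseteq> K" by (auto simp: deletion_def)
  then have "finite (\<Union>D)" "finite (\<Union>L)"
    using complex \<open>D \<subseteq> K\<close> by (meson Union_mono finite_complex_def finite_subset)+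
  then show "finite_complex D" "finite_complex L"
    using down unfolding finite_complex_def deletion_def link_def
    by (auto simp: subset_iff)
qed

text \<open>The quotient map from chains of \<open>K\<close> to chains of \<open>K\<close> modulo
  \<open>D\<close>, identified with chains of the link one degree lower.\<close>

definition lk :: "('a list \<Rightarrow> rat) \<Rightarrow> 'a list \<Rightarrow> rat" where
  "lk c = (\<lambda>xs. c (v # xs))"

lemma lk_mem: "c \<in> simplicial_chains K i \<Longrightarrow> lk c \<in> simplicial_chains L (i - 1)"
proof (rule simplicial_chainsI)
  fix xs assume c: "c \<in> simplicial_chains K i" and "lk c xs \<noteq> 0"
  then show "distinct xs \<and> set xs \<in> L \<and> int (length xs) = i - 1 + 1"
    using chain_support[OF c, of "v # xs"] by (auto simp: lk_def link_def)
next
  fix xs a b ys assume c: "c \<in> simplicial_chains K i"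
  show "lk c (xs @ b # a # ys) = - lk c (xs @ a # b # ys)"
    using chain_swap[OF c, of "v # xs" b a ys] by (simp add: lk_def)
qed

text \<open>Antisymmetry brings \<open>v\<close> to the front, so \<open>lk c\<close> determines all
  coefficients on lists containing \<open>v\<close>.\<close>

lemma lk_eq_0_iff:
  assumes "c \<in> simplicial_chains K i"
  shows "lk c = (\<lambda>_. 0) \<longleftrightarrow> c \<in> simplicial_chains D i"
proof
  assume 0: "lk c = (\<lambda>_. 0)"
  show "c \<in> simplicial_chains D i"
  proof (rule simplicial_chainsI)
    fix xs assume xs: "c xs \<noteq> 0"
    have "v \<notin> set xs"
    proof
      assume "v \<in> set xs"
      then obtain ys zs where "xs = ys @ v # zs" by (meson split_list)
      then show False using xs chain_move_front[OF assms, of ys v zs] fun_cong[OF 0, of "ys @ zs"]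
        by (simp add: lk_def)
    qed
    then show "distinct xs \<and> set xs \<in> D \<and> int (length xs) = i + 1"
      using chain_support[OF assms xs] by (simp add: deletion_def)
  qed (rule chain_swap[OF assms])
next
  assume "c \<in> simplicial_chains D i"
  then show "lk c = (\<lambda>_. 0)"
    using chain_support[of c D i "v # _"] by (fastforce simp: lk_def deletion_def)
qed

lemma link_chain_vanish:
  "d \<in> simplicial_chains L i \<Longrightarrow> v \<in> set ys \<Longrightarrow> d ys = 0"
  using chain_support[of d L i ys] by (auto simp: link_def)

lemma cone_mem:
  assumes d: "d \<in> simplicial_chains L i"
  shows "cone v d \<in> simplicial_chains K (i + 1)"
proof (rule simplicial_chainsI)
  fix xs assume "cone v d xs \<noteq> 0"
  then obtain ys zs where xs: "xs = ys @ v # zs" "d (ys @ zs) \<noteq> 0" by (rule cone_nonzeroE)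
  from chain_support[OF d this(2)] show "distinct xs \<and> set xs \<in> K \<and> int (length xs) = i + 1 + 1"
    by (auto simp: xs(1) link_def)
next
  show "cone v d (xs @ w # u # ys) = - cone v d (xs @ u # w # ys)" for xs u w ys
    by (rule cone_swap) (rule chain_swap[OF d], rule link_chain_vanish[OF d])
qed

lemma lk_cone: "lk (cone v d) = d"
  by (simp add: lk_def)

text \<open>Exchanging \<open>v\<close> with the summation vertex costs one sign.\<close>

lemma lk_boundary:
  assumes "c \<in> simplicial_chains K i"
  shows "lk (simplicial_boundary K c) = (\<lambda>xs. - simplicial_boundary K (lk c) xs)"
proof
  fix xs
  have "c (w # v # xs) = - c (v # w # xs)" for w using chain_swap[OF assms, of "[]" w v xs] by simp
  then show "lk (simplicial_boundary K c) xs = - simplicial_boundary K (lk c) xs"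
    by (simp add: lk_def simplicial_boundary_def sum_negf)
qed

text \<open>The boundary of a join is \<open>d\<close> minus the join of \<open>v\<close> with the
  boundary of \<open>d\<close>. The summand for \<open>v\<close> gives the first term, the other
  summands the second, which vanishes for a cycle.\<close>

lemma boundary_cone:
  assumes d: "d \<in> simplicial_cycles L i"
  shows "simplicial_boundary K (cone v d) = d"
proof
  fix xs
  have dL: "d \<in> simplicial_chains L i" and d0: "simplicial_boundary K d = (\<lambda>_. 0)"
    using d boundary_mono[OF L_K complex] by (auto simp: simplicial_cycles_def)
  have U: "finite (\<Union>K)" "v \<in> \<Union>K" using complex v by (auto simp: finite_complex_def)
  have "(\<Sum>w\<in>\<Union>K - {v}. d (w # zs)) = 0" for zs
    using fun_cong[OF d0, of zs] link_chain_vanish[OF dL, of "v # zs"] U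
    by (simp add: simplicial_boundary_def sum.remove[OF U])
  then have "(\<Sum>w\<in>\<Union>K - {v}. cone v (\<lambda>zs. d (w # zs)) xs) = 0"
    using cone_linear(3)[of v "\<lambda>w zs. d (w # zs)" "\<Union>K - {v}" xs] by (simp add: cone_linear(1))
  moreover have "(\<Sum>w\<in>\<Union>K - {v}. cone v d (w # xs)) = (\<Sum>w\<in>\<Union>K - {v}. - cone v (\<lambda>zs. d (w # zs)) xs)"
    by (rule sum.cong) auto
  ultimately show "simplicial_boundary K (cone v d) xs = d xs"
    by (simp add: simplicial_boundary_def sum.remove[OF U] sum_negf)
qed

lemma lk_linear:
  "lk (\<lambda>xs. c xs + d xs) = (\<lambda>xs. lk c xs + lk d xs)" "lk (\<lambda>xs. r * c xs) = (\<lambda>xs. r * lk c xs)"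
  "lk (\<lambda>xs. c xs - d xs) = (\<lambda>xs. lk c xs - lk d xs)" "lk (\<lambda>xs. - c xs) = (\<lambda>xs. - lk c xs)"
  by (simp_all add: lk_def)

lemma chains_D_subset: "simplicial_chains D i \<subseteq> simplicial_chains K i"
  and chains_L_subset: "simplicial_chains L i \<subseteq> simplicial_chains D i"
  using simplicial_chains_mono D_K L_D by blast+

lemma cycles_D_iff: "c \<in> simplicial_cycles D i \<longleftrightarrow> c \<in> simplicial_cycles K i \<and> lk c = (\<lambda>_. 0)"
proof -
  have "simplicial_boundary D c = simplicial_boundary K c" if "c \<in> simplicial_chains D i"
    using boundary_mono[OF D_K complex that] .
  then show ?thesis
    using lk_eq_0_iff chains_D_subset unfolding simplicial_cycles_def by auto
qed

lemma lk_chains: "lk ` simplicial_chains K (i + 1) = simplicial_chains L i"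
  using lk_mem[of _ "i + 1"] cone_mem[of _ i] lk_cone by (auto intro!: image_eqI[of _ lk "cone v _"])

lemma chains_split:
  "fun_dim (simplicial_chains K (i + 1)) =
     fun_dim (simplicial_chains L i) + fun_dim (simplicial_chains D (i + 1))"
proof -
  have "{c \<in> simplicial_chains K (i + 1). lk c = (\<lambda>_. 0)} = simplicial_chains D (i + 1)"
    using lk_eq_0_iff chains_D_subset by blast
  then show ?thesis
    using fun_dim_rank_nullity[OF fun_subspace_chains fin_dim_chain_subspace[OF complex fun_subspace_chains order_refl],
        of "i + 1" lk] lk_chains by (simp add: lk_linear)
qed

text \<open>This is the image of the connecting map. If \<open>c\<close> is a cycle with
  \<open>lk c = d\<close>, then \<open>cone v d\<close> minus \<open>c\<close> lies in the deletion
  and has boundary \<open>d\<close>. Conversely, if \<open>e\<close> in the deletion has boundary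
  \<open>d\<close>, then \<open>cone v d\<close> minus \<open>e\<close> is a cycle.\<close>

lemma lk_cycles: "lk ` simplicial_cycles K (i + 1) = simplicial_cycles L i \<inter> simplicial_boundaries D i"
proof (intro equalityI subsetI)
  fix d assume "d \<in> lk ` simplicial_cycles K (i + 1)"
  then obtain c where c: "c \<in> simplicial_chains K (i + 1)" "simplicial_boundary K c = (\<lambda>_. 0)" "d = lk c"
    by (auto simp: simplicial_cycles_def)
  have dL: "d \<in> simplicial_chains L i" using lk_mem[OF c(1)] c(3) by simp
  have "simplicial_boundary K d = (\<lambda>_. 0)"
    using lk_boundary[OF c(1)] by (simp add: c(2,3) lk_def fun_eq_iff)
  then have dZ: "d \<in> simplicial_cycles L i"
    using dL boundary_mono[OF L_K complex dL] by (simp add: simplicial_cycles_def)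
  define e where "e = (\<lambda>xs. cone v d xs - c xs)"
  have eK: "e \<in> simplicial_chains K (i + 1)"
    unfolding e_def by (rule chains_diff[OF cone_mem[OF dL] c(1)])
  have "lk e = (\<lambda>_. 0)" by (simp add: e_def lk_linear lk_cone c(3))
  then have eD: "e \<in> simplicial_chains D (i + 1)" using lk_eq_0_iff[OF eK] by simp
  have "simplicial_boundary K e = d"
    unfolding e_def boundary_diff by (simp add: boundary_cone[OF dZ] c(2))
  then have "d \<in> simplicial_boundaries D i"
    unfolding simplicial_boundaries_def
    by (intro image_eqI[OF _ eD]) (simp add: boundary_mono[OF D_K complex eD])
  with dZ show "d \<in> simplicial_cycles L i \<inter> simplicial_boundaries D i" by simp
next
  fix d assume "d \<in> simplicial_cycles L i \<inter> simplicial_boundaries D i"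
  then obtain e where d: "d \<in> simplicial_cycles L i" and e: "e \<in> simplicial_chains D (i + 1)"
    "d = simplicial_boundary K e"
    using boundary_mono[OF D_K complex] by (auto simp: simplicial_boundaries_def)
  have dL: "d \<in> simplicial_chains L i" using d by (simp add: simplicial_cycles_def)
  have eK: "e \<in> simplicial_chains K (i + 1)" using e chains_D_subset by blast
  define c where "c = (\<lambda>xs. cone v d xs - e xs)"
  have "c \<in> simplicial_chains K (i + 1)"
    unfolding c_def by (rule chains_diff[OF cone_mem[OF dL] eK])
  moreover have "simplicial_boundary K c = (\<lambda>_. 0)"
    unfolding c_def boundary_diff by (simp add: boundary_cone[OF d] e(2)[symmetric])
  moreover have "lk c = d"
    using lk_eq_0_iff[OF eK] e(1) by (simp add: c_def lk_linear lk_cone)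
  ultimately show "d \<in> lk ` simplicial_cycles K (i + 1)" by (auto simp: simplicial_cycles_def)
qed

lemma cycles_split:
  "fun_dim (simplicial_cycles K (i + 1)) =
     fun_dim (simplicial_cycles L i \<inter> simplicial_boundaries D i) + fun_dim (simplicial_cycles D (i + 1))"
proof -
  have "{c \<in> simplicial_cycles K (i + 1). lk c = (\<lambda>_. 0)} = simplicial_cycles D (i + 1)"
    using cycles_D_iff by blast
  then show ?thesis
    using fun_dim_rank_nullity[OF fun_subspace_cycles fin_dim_chain_subspace[OF complex fun_subspace_cycles cycles_subset_chains],
        of "i + 1" lk] lk_cycles by (simp add: lk_linear)
qed

lemma lk_boundaries: "lk ` simplicial_boundaries K (i + 1) = simplicial_boundaries L i"
proof (intro equalityI subsetI)
  fix d assume "d \<in> lk ` simplicial_boundaries K (i + 1)"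
  then obtain c where c: "c \<in> simplicial_chains K (i + 1 + 1)" "d = lk (simplicial_boundary K c)"
    by (auto simp: simplicial_boundaries_def)
  have e: "(\<lambda>xs. - lk c xs) \<in> simplicial_chains L (i + 1)"
    using lk_mem[OF c(1)] by (intro chains_uminus) (simp only: add_diff_cancel_right')
  have "d = simplicial_boundary L (\<lambda>xs. - lk c xs)"
    unfolding boundary_mono[OF L_K complex e] using c(2) lk_boundary[OF c(1)] by (simp add: boundary_uminus)
  then show "d \<in> simplicial_boundaries L i" using e by (auto simp: simplicial_boundaries_def)
next
  fix d assume "d \<in> simplicial_boundaries L i"
  then obtain e where e: "e \<in> simplicial_chains L (i + 1)" "d = simplicial_boundary K e"
    using boundary_mono[OF L_K complex] by (auto simp: simplicial_boundaries_def)
  define c where "c = (\<lambda>xs. - cone v e xs)"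
  have c: "c \<in> simplicial_chains K (i + 1 + 1)" unfolding c_def by (rule chains_uminus[OF cone_mem[OF e(1)]])
  have "lk c = (\<lambda>xs. - e xs)" by (simp add: c_def lk_linear lk_cone)
  then have "lk (simplicial_boundary K c) = d"
    using lk_boundary[OF c] by (simp add: boundary_uminus e(2))
  then show "d \<in> lk ` simplicial_boundaries K (i + 1)" using c by (auto simp: simplicial_boundaries_def)
qed

text \<open>A boundary with zero \<open>lk\<close> is a cycle of the deletion, though it may bound
  only in \<open>K\<close>. The estimate serves to bound \<rho> by the Betti numbers of the
  deletion.\<close>

lemma boundaries_bound:
  "fun_dim (simplicial_boundaries K (i + 1)) \<le>
     fun_dim (simplicial_boundaries L i) + fun_dim (simplicial_cycles D (i + 1))"
proof -
  define R where "R = {b \<in> simplicial_boundaries K (i + 1). lk b = (\<lambda>_. 0)}"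
  have sub: "simplicial_boundaries K (i + 1) \<subseteq> simplicial_chains K (i + 1)"
    using boundaries_subset_cycles[OF complex] cycles_subset_chains by blast
  have "fun_dim (simplicial_boundaries K (i + 1)) = fun_dim (simplicial_boundaries L i) + fun_dim R"
    using fun_dim_rank_nullity[OF fun_subspace_boundaries fin_dim_chain_subspace[OF complex fun_subspace_boundaries sub],
        of lk] lk_boundaries by (simp add: lk_linear R_def)
  moreover have "fun_subspace R"
    using fun_subspaceD[OF fun_subspace_boundaries[of K "i + 1"]]
    by (auto simp: fun_subspace_def R_def lk_linear) (simp add: lk_def)
  moreover have "R \<subseteq> simplicial_cycles D (i + 1)"
    using boundaries_subset_cycles[OF complex] cycles_D_iff unfolding R_def by blast
  ultimately show ?thesis
    using chain_subspace_dim_mono[OF complex_D _ fun_subspace_cycles _ cycles_subset_chains] by fastforce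
qed

lemma betti_exact_sequence:
  "\<exists>\<rho>. betti_exact (reduced_betti K) (reduced_betti D) (reduced_betti L) \<rho> \<and>
     (D = L \<longrightarrow> \<rho> = reduced_betti D)"
proof -
  let ?Z = "\<lambda>K i. fun_dim (simplicial_cycles K i)" and ?B = "\<lambda>K i. fun_dim (simplicial_boundaries K i)"
  let ?I = "\<lambda>i. fun_dim (simplicial_cycles L i \<inter> simplicial_boundaries D i)"
  \<comment> \<open>Link cycles bounding in \<open>D\<close> represent the kernel of the map from
    the homology of the link to that of the deletion, so the difference is the rank of this
    map.\<close>
  define \<rho> where "\<rho> i = ?Z L i - ?I i" for i
  have I: "?I i \<le> ?Z L i" "?B L i \<le> ?I i" for i
  proof -
    have Int: "fun_subspace (simplicial_cycles L i \<inter> simplicial_boundaries D i)"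
      by (intro fun_subspace_Int fun_subspace_cycles fun_subspace_boundaries)
    have BLD: "simplicial_boundaries L i \<subseteq> simplicial_boundaries D i"
    proof
      fix b assume "b \<in> simplicial_boundaries L i"
      then obtain c where c: "c \<in> simplicial_chains L (i + 1)" "b = simplicial_boundary L c"
        by (auto simp: simplicial_boundaries_def)
      have "b = simplicial_boundary D c" using boundary_mono[OF L_D complex_D c(1)] c(2) by simp
      then show "b \<in> simplicial_boundaries D i"
        using c(1) chains_L_subset by (auto simp: simplicial_boundaries_def)
    qed
    show "?I i \<le> ?Z L i"
      by (rule chain_subspace_dim_mono[OF complex_L Int fun_subspace_cycles Int_lower1 cycles_subset_chains])
    show "?B L i \<le> ?I i"
      using BLD boundaries_subset_cycles[OF complex_L] cycles_subset_chains
      by (intro chain_subspace_dim_mono[OF complex_L fun_subspace_boundaries Int]) blast+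
  qed
  have \<rho>: "?I i + \<rho> i = ?Z L i" for i using I(1)[of i] by (simp add: \<rho>_def)
  note beta = betti_dim[OF complex] betti_dim[OF complex_D] betti_dim[OF complex_L]
  \<comment> \<open>Chains and cycles both split over link and deletion; their difference determines
    the boundaries of \<open>K\<close>.\<close>
  have B: "?B K (i + 1) = ?B D (i + 1) + ?B L i + \<rho> (i + 1)" for i
    using chains_split[of "i + 1"] chains_dim[OF complex, of "i + 1"] chains_dim[OF complex_D, of "i + 1"]
      chains_dim[OF complex_L, of i] cycles_split[of "i + 1"] \<rho>[of "i + 1"] by linarith
  have "\<rho> i \<le> reduced_betti L i" for i using \<rho>[of i] I(2)[of i] beta(3)[of i] by linarith
  moreover have "\<rho> i \<le> reduced_betti D i" for i
    using boundaries_bound[of "i - 1"] B[of "i - 1"] beta(2)[of i] by simp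
  moreover have "reduced_betti K (i + 1) + \<rho> (i + 1) + \<rho> i = reduced_betti D (i + 1) + reduced_betti L i" for i
    using beta(1)[of "i + 1"] beta(2)[of "i + 1"] beta(3)[of i] B[of i] cycles_split[of i] \<rho>[of i] by linarith
  \<comment> \<open>Here the map is the identity and has full rank.\<close>
  moreover have "\<rho> i = reduced_betti D i" if DL: "D = L" for i
  proof -
    have "simplicial_cycles L i \<inter> simplicial_boundaries D i = simplicial_boundaries D i"
      using boundaries_subset_cycles[OF complex_D] DL by auto
    then show ?thesis using \<rho>[of i] beta(2)[of i] DL by simp
  qed
  ultimately show ?thesis unfolding betti_exact_def by (intro exI[of _ \<rho>]) auto
qed

end


section \<open>Independence complexes of ternary graphs\<close>

fun concentrated :: "(int \<Rightarrow> nat) \<Rightarrow> int option \<Rightarrow> bool" where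
  "concentrated f None \<longleftrightarrow> (\<forall>i. f i = 0)"
| "concentrated f (Some d) \<longleftrightarrow> (\<forall>i. f i = (if i = d then 1 else 0))"

lemma concentrated_unique:
  assumes "concentrated f x" "concentrated f y"
  shows "x = y"
proof (cases x)
  case None
  then have "f i = 0" for i using assms(1) by simp
  then show ?thesis using None assms(2) by (cases y) (simp_all, metis zero_neq_one)
next
  case (Some d)
  then have "f d = 1" using assms(1) by simp
  then show ?thesis using Some assms(2) by (cases y) (auto split: if_splits)
qed

lemma betti_exact_at:
  assumes "betti_exact \<gamma> \<alpha> \<beta> \<rho>"
  shows "\<gamma> i + \<rho> i + \<rho> (i - 1) = \<alpha> i + \<beta> (i - 1)" "\<rho> i \<le> \<alpha> i" "\<rho> i \<le> \<beta> i"
proof -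
  have "\<gamma> (i - 1 + 1) + \<rho> (i - 1 + 1) + \<rho> (i - 1) = \<alpha> (i - 1 + 1) + \<beta> (i - 1)"
    using assms unfolding betti_exact_def by blast
  then show "\<gamma> i + \<rho> i + \<rho> (i - 1) = \<alpha> i + \<beta> (i - 1)" by simp
  show "\<rho> i \<le> \<alpha> i" "\<rho> i \<le> \<beta> i" using assms by (simp_all add: betti_exact_def)
qed

text \<open>If \<rho> vanishes, \<gamma> is the sum of \<alpha> and the shifted \<beta>. Otherwise
  \<alpha> and \<beta> sit in a common degree and cancel. In \<open>both\<close>, \<open>e\<close>
  is the degree contributed to \<gamma>, hence \<open>e - 1\<close> for the link.\<close>

lemma betti_exact_cases:
  assumes ex: "betti_exact \<gamma> \<alpha> \<beta> \<rho>" and y: "concentrated \<alpha> y" and z: "concentrated \<beta> z"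
  obtains
    (zero) "y = z" "concentrated \<gamma> None"
  | (link) "y = None" "concentrated \<gamma> (map_option (\<lambda>d. d + 1) z)"
  | (deletion) "z = None" "concentrated \<gamma> y"
  | (both) d e where "y = Some d" "z = Some (e - 1)"
      "\<And>i. \<gamma> i = (if i = d then 1 else 0) + (if i = e then 1 else 0)"
proof (cases "\<forall>i. \<rho> i = 0")
  case True
  then have g: "\<gamma> i = \<alpha> i + \<beta> (i - 1)" for i using betti_exact_at(1)[OF ex, of i] by simp
  show thesis
  proof (cases y)
    case None
    then have "concentrated \<gamma> (map_option (\<lambda>d. d + 1) z)" using y z g by (cases z) auto
    with None show thesis by (rule link)
  next
    case (Some d)
    show thesis
    proof (cases z)
      case None
      then have "concentrated \<gamma> y" using y z g by (cases y) auto
      with None show thesis by (rule deletion)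
    next
      case (Some e)
      show thesis
        by (rule both[of d "e + 1"]) (use g y z \<open>y = Some d\<close> Some in auto)
    qed
  qed
next
  case False
  then obtain d where d: "\<rho> d \<noteq> 0" by blast
  have at: "x = Some d" if "concentrated f x" "\<rho> d \<le> f d" for f x
    using that d by (cases x) (auto split: if_splits)
  have yz: "y = Some d" "z = Some d" using at y z betti_exact_at(2,3)[OF ex] by blast+
  have ab: "\<alpha> i = (if i = d then 1 else 0)" "\<beta> i = (if i = d then 1 else 0)" for i
    using y z yz by simp_all
  have r: "\<rho> i = (if i = d then 1 else 0)" for i
    using betti_exact_at(2)[OF ex, of i] d ab(1)[of i] by (cases "i = d") auto
  have "\<gamma> i = 0" for i using betti_exact_at(1)[OF ex, of i] by (simp add: ab r)
  then show thesis using zero yz by simp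
qed

text \<open>All cases but \<open>both\<close> are alternatives of \<open>exact_degrees\<close>;
  \<open>both\<close> gives total dimension two, against the concentration of \<gamma>.\<close>

lemma exact_degreesI:
  assumes ex: "betti_exact \<gamma> \<alpha> \<beta> \<rho>"
    and x: "concentrated \<gamma> x" and y: "concentrated \<alpha> y" and z: "concentrated \<beta> z"
  shows "exact_degrees x y z"
  using ex y z
proof (cases rule: betti_exact_cases)
  case zero
  then show ?thesis using concentrated_unique[OF x] by (metis exact_degrees_def)
next
  case link
  then show ?thesis using concentrated_unique[OF x] by (metis exact_degrees_def)
next
  case deletion
  then show ?thesis using concentrated_unique[OF x] by (metis exact_degrees_def)
next
  case (both d e)
  have "\<gamma> d \<noteq> 0" "\<gamma> e \<noteq> 0" using both(3) by simp_all
  then have "d = e" "\<gamma> d = 1" using x by (cases x; auto split: if_splits)+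
  then show ?thesis using both(3)[of d] by simp
qed

text \<open>In every case but \<open>both\<close>, \<gamma> would be concentrated.\<close>

lemma critical_degrees:
  assumes ex: "betti_exact \<gamma> \<alpha> \<beta> \<rho>" and not: "\<And>x. \<not> concentrated \<gamma> x"
    and y: "concentrated \<alpha> y" and z: "concentrated \<beta> z"
  shows "y \<noteq> None \<and> z \<noteq> None"
  using ex y z
proof (cases rule: betti_exact_cases)
  case (both d e)
  then show ?thesis by simp
qed (use not in blast)+

text \<open>The independence complex of an induced subgraph, with the edge relation kept fixed while
  the vertex set shrinks.\<close>

definition indep :: "('a \<times> 'a) set \<Rightarrow> 'a set \<Rightarrow> 'a set set" where
  "indep E W = {S. S \<subseteq> W \<and> (\<forall>u\<in>S. \<forall>v\<in>S. (u, v) \<notin> E)}"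

text \<open>An independent set containing \<open>v\<close> avoids its neighbours, which identifies
  the link. For isolated \<open>v\<close>, deletion and link coincide.\<close>

lemma indep_betti_exact:
  assumes W: "finite W" "v \<in> W" and sym: "\<And>u v. (u, v) \<in> E \<Longrightarrow> (v, u) \<in> E" and irr: "\<And>u. (u, u) \<notin> E"
  obtains \<rho> where "betti_exact (reduced_betti (indep E W)) (reduced_betti (indep E (W - {v})))
      (reduced_betti (indep E (W - insert v {u. (v, u) \<in> E}))) \<rho>"
    "W \<inter> {u. (v, u) \<in> E} = {} \<Longrightarrow> \<rho> = reduced_betti (indep E (W - {v}))"
proof -
  have D: "deletion (indep E W) v = indep E (W - {v})" by (auto simp: deletion_def indep_def)
  have L: "link (indep E W) v = indep E (W - insert v {u. (v, u) \<in> E})"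
    using W(2) irr sym unfolding link_def indep_def by blast
  have "complex_vertex (indep E W) v"
  proof
    have "\<Union> (indep E W) \<subseteq> W" by (auto simp: indep_def)
    then have "finite (\<Union> (indep E W))" using W(1) by (rule finite_subset)
    then show "finite_complex (indep E W)" unfolding finite_complex_def indep_def by blast
    show "{v} \<in> indep E W" using W irr by (auto simp: indep_def)
  qed
  then interpret complex_vertex "indep E W" v .
  let ?D = "deletion (indep E W) v" and ?L = "link (indep E W) v"
  obtain \<rho> where ex: "betti_exact (reduced_betti (indep E W)) (reduced_betti ?D) (reduced_betti ?L) \<rho>"
    and eq: "?D = ?L \<longrightarrow> \<rho> = reduced_betti ?D"
    using betti_exact_sequence by blast
  have "\<rho> = reduced_betti (indep E (W - {v}))" if "W \<inter> {u. (v, u) \<in> E} = {}"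
  proof -
    have "W - {v} = W - insert v {u. (v, u) \<in> E}" using that by auto
    then show ?thesis using eq unfolding D L by simp
  qed
  with ex[unfolded D L] show thesis by (rule that)
qed

text \<open>The complex is a cone with apex \<open>v\<close>: the map from link to deletion has full
  rank and leaves no homology.\<close>

lemma isolated_betti_zero:
  assumes "finite W" "v \<in> W" "\<And>u v. (u, v) \<in> E \<Longrightarrow> (v, u) \<in> E" "\<And>u. (u, u) \<notin> E"
    and iso: "W \<inter> {u. (v, u) \<in> E} = {}"
  shows "concentrated (reduced_betti (indep E W)) None"
proof -
  have eq: "W - insert v {u. (v, u) \<in> E} = W - {v}" using iso by auto
  obtain \<rho> where ex: "betti_exact (reduced_betti (indep E W)) (reduced_betti (indep E (W - {v})))
      (reduced_betti (indep E (W - {v}))) \<rho>" "\<rho> = reduced_betti (indep E (W - {v}))"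
    using indep_betti_exact[OF assms(1-4)] iso unfolding eq by metis
  have "reduced_betti (indep E W) i = 0" for i
    using betti_exact_at(1)[OF ex(1), of i] by (simp add: ex(2))
  then show ?thesis by simp
qed

text \<open>The empty set is the only face, so chains live on \<open>[]\<close> in degree -1; a
  dimension of at most one there already gives concentration.\<close>

lemma empty_betti: "\<exists>x. concentrated (reduced_betti (indep E {})) x"
proof -
  have K: "finite_complex (indep E {})" by (auto simp: finite_complex_def indep_def)
  have supp: "xs \<in> (if i = -1 then {[]} else {})" if "c \<in> simplicial_cycles (indep E {}) i" "c xs \<noteq> 0" for c xs i
    using chain_support[of c "indep E {}" i xs] that by (auto simp: simplicial_cycles_def indep_def)
  have b: "reduced_betti (indep E {}) i \<le> (if i = -1 then 1 else 0)" for i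
  proof -
    have "fun_dim (simplicial_cycles (indep E {}) i) \<le> card (if i = -1 then {[] :: 'a list} else {})"
      by (rule fun_dim_le_card[OF fun_subspace_cycles _ supp]) auto
    then show ?thesis using betti_dim[OF K, of i] by (cases "i = -1") simp_all
  qed
  show ?thesis
  proof (cases "reduced_betti (indep E {}) (-1) = 0")
    case True
    then have "reduced_betti (indep E {}) i = 0" for i using b[of i] by (cases "i = -1") auto
    then show ?thesis by (intro exI[of _ None]) simp
  next
    case False
    then have "reduced_betti (indep E {}) i = (if i = -1 then 1 else 0)" for i
      using b[of i] by (cases "i = -1") auto
    then show ?thesis by (intro exI[of _ "Some (-1)"]) simp
  qed
qed

theorem ternary_betti_concentrated:
  fixes E :: "('a \<times> 'a) set"
  assumes "finite V" and sym: "\<And>u v. (u, v) \<in> E \<Longrightarrow> (v, u) \<in> E" and irr: "\<And>u. (u, u) \<notin> E"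
    and ternary: "\<And>vs. 3 \<le> length vs \<Longrightarrow> 3 dvd length vs \<Longrightarrow> distinct vs \<Longrightarrow> set vs \<subseteq> V \<Longrightarrow>
      \<not> (\<forall>i < length vs. \<forall>j < length vs.
          (vs ! i, vs ! j) \<in> E \<longleftrightarrow> j = Suc i mod length vs \<or> i = Suc j mod length vs)"
  shows "\<exists>x. concentrated (reduced_betti (indep E V)) x"
  using assms(1) ternary
proof (induction V rule: finite_psubset_induct)
  case (psubset V)
  show ?case
  proof (rule ccontr)
    assume "\<not> ?case"
    then have not: "\<not> concentrated (reduced_betti (indep E V)) x" for x by blast
    \<comment> \<open>The choice is used only for proper subsets, where the induction hypothesis
      supplies a value.\<close>
    define deg where "deg W = (SOME x. concentrated (reduced_betti (indep E W)) x)" for W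
    have deg: "concentrated (reduced_betti (indep E W)) (deg W)" if "W \<subset> V" for W
    proof -
      have "\<exists>x. concentrated (reduced_betti (indep E W)) x"
      proof (rule psubset.IH[OF that])
        fix vs assume "3 \<le> length vs" "3 dvd length vs" "distinct vs" "set vs \<subseteq> W"
        then show "\<not> (\<forall>i < length vs. \<forall>j < length vs.
          (vs ! i, vs ! j) \<in> E \<longleftrightarrow> j = Suc i mod length vs \<or> i = Suc j mod length vs)"
          using psubset.prems[of vs] that by auto
      qed
      then show ?thesis unfolding deg_def by (rule someI_ex)
    qed
    have ne: "V \<noteq> {}" using not empty_betti by blast
    interpret critical_graph V E deg
    proof
      show "finite V" "V \<noteq> {}" by (fact psubset.hyps ne)+
      show "(u, v) \<in> E \<Longrightarrow> (v, u) \<in> E" for u v by (rule sym)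
      show "(u, u) \<notin> E" for u by (rule irr)
      show "\<exists>u\<in>V. (v, u) \<in> E" if "v \<in> V" for v
        using isolated_betti_zero[OF psubset.hyps that sym irr] not by blast
      show "exact_degrees (deg W) (deg (W - {v})) (deg (W - insert v {u. (v, u) \<in> E}))"
        if Wv: "W \<subset> V" "v \<in> W" for W v
      proof -
        have W: "finite W" using Wv psubset.hyps finite_subset by blast
        obtain \<rho> where ex: "betti_exact (reduced_betti (indep E W)) (reduced_betti (indep E (W - {v})))
          (reduced_betti (indep E (W - insert v {u. (v, u) \<in> E}))) \<rho>"
          using indep_betti_exact[OF W Wv(2) sym irr] .
        show ?thesis by (rule exact_degreesI[OF ex deg deg deg]) (use Wv in auto)
      qed
      show "deg (V - {v}) \<noteq> None \<and> deg (V - insert v {u. (v, u) \<in> E}) \<noteq> None" if v: "v \<in> V" for v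
      proof -
        obtain \<rho> where ex: "betti_exact (reduced_betti (indep E V)) (reduced_betti (indep E (V - {v})))
          (reduced_betti (indep E (V - insert v {u. (v, u) \<in> E}))) \<rho>"
          using indep_betti_exact[OF psubset.hyps v sym irr] .
        show ?thesis by (rule critical_degrees[OF ex not deg deg]) (use v in auto)
      qed
    qed
    obtain vs where "3 \<le> length vs" "3 dvd length vs" "distinct vs" "set vs \<subseteq> V"
      "\<And>i j. i < length vs \<Longrightarrow> j < length vs \<Longrightarrow>
         (vs ! i, vs ! j) \<in> E \<longleftrightarrow> j = Suc i mod length vs \<or> i = Suc j mod length vs"
      using induced_cycle_exists by blast
    then show False using psubset.prems[of vs] by blast
  qed
qed

theorem theorem2:
  fixes G :: "'a pair_pre_digraph"
  assumes "pair_graph G"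
    and "\<not> (\<exists>vs. induced_cycle G vs \<and> 3 dvd length vs)"
  shows "total_reduced_betti G \<le> 1"
proof -
  interpret pair_graph G by fact
  have "\<exists>x. concentrated (reduced_betti (indep (parcs G) (pverts G))) x"
  proof (rule ternary_betti_concentrated)
    show "finite (pverts G)" by simp
    show "(u, v) \<in> parcs G \<Longrightarrow> (v, u) \<in> parcs G" for u v
      by (rule arcs_symmetric)
    show "(u, u) \<notin> parcs G" for u using no_loops[of "(u, u)"] by auto
  qed (use assms(2) in \<open>auto simp: induced_cycle_def\<close>)
  then obtain x where x: "concentrated (reduced_betti (indep (parcs G) (pverts G))) x" ..
  have "total_reduced_betti G = (\<Sum>i\<in>{-1..<int (card (pverts G))}. reduced_betti (indep (parcs G) (pverts G)) i)"
    by (simp add: total_reduced_betti_def independence_complex_def indep_def)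
  \<comment> \<open>At most one summand is nonzero, and it equals one.\<close>
  also have "\<dots> \<le> 1" using x by (cases x) auto
  finally show ?thesis .
qed

end
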